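(* Let $T:\mathbf{X}\to\mathbf{B}^{op}$ be a functor, where $\mathbf{X}$ is a category and $\mathbf{B}$ is a variety of algebras. Then: (1) There exists a full embedding $IE:\mathbf{SAfInst}(T)\hookrightarrow\mathbf{AfInst}(T)$, given on a morphism $(\Phi,\alpha):(\mathbf{S}_1,I_1)\to(\mathbf{S}_2,I_2)$ by $IE(\Phi,\alpha)=(\Phi,E\alpha):(\mathbf{S}_1,EI_1)\to(\mathbf{S}_2,EI_2)$. (2) $IE$ has a right-adjoint-left-inverse $ISpat:\mathbf{AfInst}(T)\to\mathbf{SAfInst}(T)$, given on a morphism $(\Phi,\alpha):(\mathbf{S}_1,I_1)\to(\mathbf{S}_2,I_2)$ by $ISpat(\Phi,\alpha)=(\Phi,Spat\,\alpha):(\mathbf{S}_1,Spat\,I_1)\to(\mathbf{S}_2,Spat\,I_2)$. (3) $\mathbf{SAfInst}(T)$ is isomorphic to a full coreflective subcategory of $\mathbf{AfInst}(T)$.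
   Context: **Algebras and varieties.** Let $\Omega=(n_\lambda)_{\lambda\in\Lambda}$ be a family of cardinal numbers indexed by a (possibly proper or empty) class $\Lambda$. An $\Omega$-algebra is a set $A$ with maps $\omega^A_\lambda:A^{n_\lambda}\to A$ ($\lambda\in\Lambda$); an $\Omega$-homomorphism is a map $\varphi:A\to B$ with $\varphi\circ\omega^A_\lambda=\omega^B_\lambda\circ\varphi^{n_\lambda}$ for every $\lambda\in\Lambda$. A variety of algebras $\mathbf{B}$ is a full subcategory of the category of $\Omega$-algebras and $\Omega$-homomorphisms (for some $\Omega$) that is closed under products, subalgebras and homomorphic images. $\mathbf{B}^{op}$ is the opposite category; for a morphism $\varphi:B_1\to B_2$ of $\mathbf{B}^{op}$, $\varphi^{op}:B_2\to B_1$ denotes the corresponding homomorphism in $\mathbf{B}$. For a map $f:X\to Y$ and $R\subseteq X$, $f^{\rightarrow}(R)=\{f(r)\mid r\in R\}$. No distinction is made between categories and quasicategories (i.e. size issues are ignored: objects need not form a class and hom-families need not be sets). **$T$-spaces.** $\mathbf{Af\,Spc}(T)$ is the category whose objects are pairs $(X,\tau)$ with $X$ an object of $\mathbf{X}$ and $\tau$ a $\mathbf{B}$-subalgebra of $TX$; morphisms $(X_1,\tau_1)\to(X_2,\tau_2)$ are $\mathbf{X}$-morphisms $f:X_1\to X_2$ such that $(Tf)^{op}(\alpha)\in\tau_1$ for every $\alpha\in\tau_2$. **$T$-systems.** $\mathbf{Af\,Sys}(T)$ is the comma category $(T\downarrow 1_{\mathbf{B}^{op}})$: its objects are triples $(X,\kappa,B)$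 with $\kappa:TX\to B$ a morphism of $\mathbf{B}^{op}$; its morphisms $(X_1,\kappa_1,B_1)\to(X_2,\kappa_2,B_2)$ are pairs $(f,\varphi)$, $f:X_1\to X_2$ in $\mathbf{X}$, $\varphi:B_1\to B_2$ in $\mathbf{B}^{op}$, with $\kappa_2\circ Tf=\varphi\circ\kappa_1$. **The functors $E$ and $Spat$.** $E:\mathbf{Af\,Spc}(T)\to\mathbf{Af\,Sys}(T)$ sends $f:(X_1,\tau_1)\to(X_2,\tau_2)$ to $(f,\varphi):(X_1,e_{\tau_1}^{op},\tau_1)\to(X_2,e_{\tau_2}^{op},\tau_2)$, where $e_{\tau_i}:\tau_i\hookrightarrow TX_i$ is the inclusion and $\varphi^{op}:\tau_2\to\tau_1$ is the restriction of $(Tf)^{op}$. $Spat:\mathbf{Af\,Sys}(T)\to\mathbf{Af\,Spc}(T)$ sends $(f,\varphi):(X_1,\kappa_1,B_1)\to(X_2,\kappa_2,B_2)$ to $f:(X_1,(\kappa_1^{op})^{\rightarrow}(B_1))\to(X_2,(\kappa_2^{op})^{\rightarrow}(B_2))$. **Institutions.** $\mathbf{AfInst}(T)$ (affine institutions over $T$) is the category whose objects are pairs $(\mathbf{S},I)$ consisting of a category $\mathbf{S}$ (of abstract signatures) and a functor $I:\mathbf{S}\to\mathbf{Af\,Sys}(T)$; a morphism $(\mathbf{S}_1,I_1)\to(\mathbf{S}_2,I_2)$ is a pair $(\Phi,\alpha)$ with $\Phi:\mathbf{S}_1\to\mathbf{S}_2$ a functor and $\alpha:I_1\to I_2\Phi$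 a natural transformation. Composition is $(\Phi',\alpha')\circ(\Phi,\alpha)=(\Phi'\Phi,\ \alpha'\Phi\circ\alpha)$, and identities are the evident ones. $\mathbf{SAfInst}(T)$ (spatial affine $T$-institutions) is defined in exactly the same way with $\mathbf{Af\,Sys}(T)$ replaced by $\mathbf{Af\,Spc}(T)$. **Terminology.** A full embedding is a functor that is full, faithful and injective on objects. A right-adjoint-left-inverse of a functor $F$ is a functor $G$ that is a right adjoint of $F$ and satisfies $GF=1$. $E\alpha$, $Spat\,\alpha$ denote whiskering of natural transformations with functors. *)

theory Defs
  imports Main "HOL-Library.FuncSet"
begin

section \<open>Categories, functors, natural transformations\<close>

text \<open>Throughout, maps are extensional, i.e. undefined outside their intended domain. Equality of
  HOL terms is then equality of categories, functors, algebras etc., which matters for injectivity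
  on objects and for equations between functors. Objects and arrows may form arbitrary sets of
  arbitrary types, so there is no distinction between categories and quasicategories.\<close>

record ('o, 'a) category =
  Obj :: "'o set"
  Arr :: "'a set"
  Dom :: "'a \<Rightarrow> 'o"
  Cod :: "'a \<Rightarrow> 'o"
  Ident :: "'o \<Rightarrow> 'a"
  Comp :: "'a \<Rightarrow> 'a \<Rightarrow> 'a"

definition Hom :: "('o, 'a) category \<Rightarrow> 'o \<Rightarrow> 'o \<Rightarrow> 'a set" where
  "Hom C a b = {f \<in> Arr C. Dom C f = a \<and> Cod C f = b}"

locale category =
  fixes C :: "('o, 'a) category"
  assumes Dom_in: "Dom C \<in> Arr C \<rightarrow>\<^sub>E Obj C"
    and Cod_in: "Cod C \<in> Arr C \<rightarrow>\<^sub>E Obj C"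
    and Ident_ext: "Ident C \<in> extensional (Obj C)"
    and Ident_in: "a \<in> Obj C \<Longrightarrow> Ident C a \<in> Hom C a a"
    and Comp_ext: "\<not> (f \<in> Arr C \<and> g \<in> Arr C \<and> Dom C g = Cod C f) \<Longrightarrow> Comp C g f = undefined"
    and Comp_in: "f \<in> Hom C a b \<Longrightarrow> g \<in> Hom C b c \<Longrightarrow> Comp C g f \<in> Hom C a c"
    and Comp_Ident_left: "f \<in> Hom C a b \<Longrightarrow> Comp C (Ident C b) f = f"
    and Comp_Ident_right: "f \<in> Hom C a b \<Longrightarrow> Comp C f (Ident C a) = f"
    and Comp_assoc: "f \<in> Hom C a b \<Longrightarrow> g \<in> Hom C b c \<Longrightarrow> h \<in> Hom C c d \<Longrightarrow>
      Comp C h (Comp C g f) = Comp C (Comp C h g) f"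

definition op_cat :: "('o, 'a) category \<Rightarrow> ('o, 'a) category" where
  "op_cat C = \<lparr>Obj = Obj C, Arr = Arr C, Dom = Cod C, Cod = Dom C, Ident = Ident C,
     Comp = (\<lambda>g f. Comp C f g)\<rparr>"

text \<open>Categories whose arrows from \<open>a\<close> to \<open>b\<close> are triples \<open>(a, m, b)\<close> with \<open>m \<in> H a b\<close>.
  The composite of the underlying \<open>m\<close> and \<open>m'\<close> may depend on the domain \<open>a\<close>: it is \<open>c a m' m\<close>.\<close>

abbreviation (input) src :: "'o \<times> 'm \<times> 'o \<Rightarrow> 'o" where "src f \<equiv> fst f"
abbreviation (input) mor :: "'o \<times> 'm \<times> 'o \<Rightarrow> 'm" where "mor f \<equiv> fst (snd f)"
abbreviation (input) tgt :: "'o \<times> 'm \<times> 'o \<Rightarrow> 'o" where "tgt f \<equiv> snd (snd f)"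

definition triple_cat :: "'o set \<Rightarrow> ('o \<Rightarrow> 'o \<Rightarrow> 'm set) \<Rightarrow> ('o \<Rightarrow> 'm) \<Rightarrow> ('o \<Rightarrow> 'm \<Rightarrow> 'm \<Rightarrow> 'm) \<Rightarrow>
    ('o, 'o \<times> 'm \<times> 'o) category" where
  "triple_cat Ob H i c =
    (let Ar = {(a, m, b). a \<in> Ob \<and> b \<in> Ob \<and> m \<in> H a b} in
     \<lparr>Obj = Ob, Arr = Ar, Dom = (\<lambda>f\<in>Ar. src f), Cod = (\<lambda>f\<in>Ar. tgt f),
      Ident = (\<lambda>a\<in>Ob. (a, i a, a)),
      Comp = (\<lambda>g f. if f \<in> Ar \<and> g \<in> Ar \<and> src g = tgt f
                     then (src f, c (src f) (mor g) (mor f), tgt g) else undefined)\<rparr>)"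

record ('o1, 'a1, 'o2, 'a2) func =
  ObjMap :: "'o1 \<Rightarrow> 'o2"
  ArrMap :: "'a1 \<Rightarrow> 'a2"

definition is_functor ::
    "('o1, 'a1) category \<Rightarrow> ('o2, 'a2) category \<Rightarrow> ('o1, 'a1, 'o2, 'a2) func \<Rightarrow> bool" where
  "is_functor C D F \<longleftrightarrow> category C \<and> category D \<and>
     ObjMap F \<in> Obj C \<rightarrow>\<^sub>E Obj D \<and>
     ArrMap F \<in> extensional (Arr C) \<and>
     (\<forall>a\<in>Obj C. \<forall>b\<in>Obj C. \<forall>f\<in>Hom C a b. ArrMap F f \<in> Hom D (ObjMap F a) (ObjMap F b)) \<and>
     (\<forall>a\<in>Obj C. ArrMap F (Ident C a) = Ident D (ObjMap F a)) \<and>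
     (\<forall>f\<in>Arr C. \<forall>g\<in>Arr C. Dom C g = Cod C f \<longrightarrow>
        ArrMap F (Comp C g f) = Comp D (ArrMap F g) (ArrMap F f))"

definition id_func :: "('o, 'a) category \<Rightarrow> ('o, 'a, 'o, 'a) func" where
  "id_func C = \<lparr>ObjMap = (\<lambda>a\<in>Obj C. a), ArrMap = (\<lambda>f\<in>Arr C. f)\<rparr>"

text \<open>\<open>comp_func C G F\<close> is the composite of functors \<open>F\<close> (with domain \<open>C\<close>) and \<open>G\<close>.\<close>

definition comp_func :: "('o1, 'a1) category \<Rightarrow> ('o2, 'a2, 'o3, 'a3) func \<Rightarrow>
    ('o1, 'a1, 'o2, 'a2) func \<Rightarrow> ('o1, 'a1, 'o3, 'a3) func" where
  "comp_func C G F = \<lparr>ObjMap = compose (Obj C) (ObjMap G) (ObjMap F),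
     ArrMap = compose (Arr C) (ArrMap G) (ArrMap F)\<rparr>"

definition nat_trans :: "('o1, 'a1) category \<Rightarrow> ('o2, 'a2) category \<Rightarrow>
    ('o1, 'a1, 'o2, 'a2) func \<Rightarrow> ('o1, 'a1, 'o2, 'a2) func \<Rightarrow> ('o1 \<Rightarrow> 'a2) \<Rightarrow> bool" where
  "nat_trans C D F G \<alpha> \<longleftrightarrow> is_functor C D F \<and> is_functor C D G \<and>
     \<alpha> \<in> extensional (Obj C) \<and>
     (\<forall>a\<in>Obj C. \<alpha> a \<in> Hom D (ObjMap F a) (ObjMap G a)) \<and>
     (\<forall>a\<in>Obj C. \<forall>b\<in>Obj C. \<forall>f\<in>Hom C a b.
        Comp D (\<alpha> b) (ArrMap F f) = Comp D (ArrMap G f) (\<alpha> a))"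

definition id_nat ::
    "('o1, 'a1) category \<Rightarrow> ('o2, 'a2) category \<Rightarrow> ('o1, 'a1, 'o2, 'a2) func \<Rightarrow> 'o1 \<Rightarrow> 'a2" where
  "id_nat C D F = (\<lambda>a\<in>Obj C. Ident D (ObjMap F a))"

definition comp_nat :: "('o1, 'a1) category \<Rightarrow> ('o2, 'a2) category \<Rightarrow>
    ('o1 \<Rightarrow> 'a2) \<Rightarrow> ('o1 \<Rightarrow> 'a2) \<Rightarrow> 'o1 \<Rightarrow> 'a2" where
  "comp_nat C D \<beta> \<alpha> = (\<lambda>a\<in>Obj C. Comp D (\<beta> a) (\<alpha> a))"

text \<open>The whiskerings \<open>K\<alpha>\<close> and \<open>\<alpha>\<Phi>\<close>; in both, \<open>C\<close> is the domain of the functors between which the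
  result is a transformation.\<close>

definition whisker_left :: "('o1, 'a1) category \<Rightarrow> ('o2, 'a2, 'o3, 'a3) func \<Rightarrow>
    ('o1 \<Rightarrow> 'a2) \<Rightarrow> 'o1 \<Rightarrow> 'a3" where
  "whisker_left C K \<alpha> = (\<lambda>a\<in>Obj C. ArrMap K (\<alpha> a))"

definition whisker_right :: "('o1, 'a1) category \<Rightarrow> ('o2 \<Rightarrow> 'a3) \<Rightarrow>
    ('o1, 'a1, 'o2, 'a2) func \<Rightarrow> 'o1 \<Rightarrow> 'a3" where
  "whisker_right C \<alpha> \<Phi> = (\<lambda>a\<in>Obj C. \<alpha> (ObjMap \<Phi> a))"

definition full_embedding ::
    "('o1, 'a1) category \<Rightarrow> ('o2, 'a2) category \<Rightarrow> ('o1, 'a1, 'o2, 'a2) func \<Rightarrow> bool" where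
  "full_embedding C D F \<longleftrightarrow> is_functor C D F \<and>
     (\<forall>a\<in>Obj C. \<forall>b\<in>Obj C. \<forall>g\<in>Hom D (ObjMap F a) (ObjMap F b). \<exists>f\<in>Hom C a b. ArrMap F f = g) \<and>
     (\<forall>a\<in>Obj C. \<forall>b\<in>Obj C. inj_on (ArrMap F) (Hom C a b)) \<and>
     inj_on (ObjMap F) (Obj C)"

text \<open>\<open>right_adjoint C D F G\<close>: the functor \<open>G : D \<rightarrow> C\<close> is a right adjoint of \<open>F : C \<rightarrow> D\<close>.\<close>

definition right_adjoint :: "('o1, 'a1) category \<Rightarrow> ('o2, 'a2) category \<Rightarrow>
    ('o1, 'a1, 'o2, 'a2) func \<Rightarrow> ('o2, 'a2, 'o1, 'a1) func \<Rightarrow> bool" where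
  "right_adjoint C D F G \<longleftrightarrow> is_functor C D F \<and> is_functor D C G \<and>
     (\<exists>\<eta> \<epsilon>. nat_trans C C (id_func C) (comp_func C G F) \<eta> \<and>
            nat_trans D D (comp_func D F G) (id_func D) \<epsilon> \<and>
            (\<forall>a\<in>Obj C. Comp D (\<epsilon> (ObjMap F a)) (ArrMap F (\<eta> a)) = Ident D (ObjMap F a)) \<and>
            (\<forall>b\<in>Obj D. Comp C (ArrMap G (\<epsilon> b)) (\<eta> (ObjMap G b)) = Ident C (ObjMap G b)))"

definition right_adjoint_left_inverse :: "('o1, 'a1) category \<Rightarrow> ('o2, 'a2) category \<Rightarrow>
    ('o1, 'a1, 'o2, 'a2) func \<Rightarrow> ('o2, 'a2, 'o1, 'a1) func \<Rightarrow> bool" where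
  "right_adjoint_left_inverse C D F G \<longleftrightarrow> right_adjoint C D F G \<and> comp_func C G F = id_func C"

definition isomorphic_cat :: "('o1, 'a1) category \<Rightarrow> ('o2, 'a2) category \<Rightarrow> bool" where
  "isomorphic_cat C D \<longleftrightarrow> (\<exists>F G. is_functor C D F \<and> is_functor D C G \<and>
     comp_func C G F = id_func C \<and> comp_func D F G = id_func D)"

definition full_subcategory :: "('o, 'a) category \<Rightarrow> ('o, 'a) category \<Rightarrow> bool" where
  "full_subcategory D C \<longleftrightarrow> category D \<and> category C \<and>
     Obj D \<subseteq> Obj C \<and> Arr D \<subseteq> Arr C \<and>
     (\<forall>f\<in>Arr D. Dom D f = Dom C f \<and> Cod D f = Cod C f) \<and>
     (\<forall>a\<in>Obj D. Ident D a = Ident C a) \<and>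
     (\<forall>f\<in>Arr D. \<forall>g\<in>Arr D. Dom D g = Cod D f \<longrightarrow> Comp D g f = Comp C g f) \<and>
     (\<forall>a\<in>Obj D. \<forall>b\<in>Obj D. Hom D a b = Hom C a b)"

text \<open>For a subcategory \<open>D\<close> of \<open>C\<close>, \<open>id_func D\<close> viewed as a functor from \<open>D\<close> to \<open>C\<close> is the
  inclusion.\<close>

definition full_coreflective_subcategory :: "('o, 'a) category \<Rightarrow> ('o, 'a) category \<Rightarrow> bool" where
  "full_coreflective_subcategory D C \<longleftrightarrow>
     full_subcategory D C \<and> (\<exists>R. right_adjoint D C (id_func D) R)"

text \<open>The comma category of \<open>F : A \<rightarrow> C\<close> and \<open>G : B \<rightarrow> C\<close>.\<close>

definition comma_cat :: "('oa, 'aa) category \<Rightarrow> ('ob, 'ab) category \<Rightarrow> ('oc, 'ac) category \<Rightarrow>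
    ('oa, 'aa, 'oc, 'ac) func \<Rightarrow> ('ob, 'ab, 'oc, 'ac) func \<Rightarrow>
    ('oa \<times> 'ac \<times> 'ob, ('oa \<times> 'ac \<times> 'ob) \<times> ('aa \<times> 'ab) \<times> ('oa \<times> 'ac \<times> 'ob)) category" where
  "comma_cat A B C F G = triple_cat
     {(a, h, b). a \<in> Obj A \<and> b \<in> Obj B \<and> h \<in> Hom C (ObjMap F a) (ObjMap G b)}
     (\<lambda>(a1, h1, b1) (a2, h2, b2). {(f, g). f \<in> Hom A a1 a2 \<and> g \<in> Hom B b1 b2 \<and>
        Comp C h2 (ArrMap F f) = Comp C (ArrMap G g) h1})
     (\<lambda>(a, h, b). (Ident A a, Ident B b))
     (\<lambda>_ (f', g') (f, g). (Comp A f' f, Comp B g' g))"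


section \<open>Algebras and varieties\<close>

text \<open>\<open>Ops \<Omega>\<close> is the index class \<open>\<Lambda>\<close>; the cardinal \<open>n\<^sub>\<lambda>\<close> is represented by an index set
  \<open>Arity \<Omega> \<lambda>\<close> of that size, finite or infinite, so that \<open>A\<^sup>n\<close> becomes an extensional function
  space.\<close>

record ('l, 'i) optype =
  Ops :: "'l set"
  Arity :: "'l \<Rightarrow> 'i set"

record ('l, 'i, 'b) algebra =
  Carrier :: "'b set"
  Op :: "'l \<Rightarrow> ('i \<Rightarrow> 'b) \<Rightarrow> 'b"

definition is_algebra :: "('l, 'i) optype \<Rightarrow> ('l, 'i, 'b) algebra \<Rightarrow> bool" where
  "is_algebra \<Omega> A \<longleftrightarrow>
     Op A \<in> (\<Pi>\<^sub>E l\<in>Ops \<Omega>. (Arity \<Omega> l \<rightarrow>\<^sub>E Carrier A) \<rightarrow>\<^sub>E Carrier A)"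

definition alg_hom ::
    "('l, 'i) optype \<Rightarrow> ('l, 'i, 'b) algebra \<Rightarrow> ('l, 'i, 'c) algebra \<Rightarrow> ('b \<Rightarrow> 'c) set" where
  "alg_hom \<Omega> A B = {\<phi> \<in> Carrier A \<rightarrow>\<^sub>E Carrier B.
     \<forall>l\<in>Ops \<Omega>. \<forall>x \<in> Arity \<Omega> l \<rightarrow>\<^sub>E Carrier A. \<phi> (Op A l x) = Op B l (compose (Arity \<Omega> l) \<phi> x)}"

definition subalgebra ::
    "('l, 'i) optype \<Rightarrow> ('l, 'i, 'b) algebra \<Rightarrow> ('l, 'i, 'b) algebra \<Rightarrow> bool" where
  "subalgebra \<Omega> S A \<longleftrightarrow> is_algebra \<Omega> S \<and> is_algebra \<Omega> A \<and> Carrier S \<subseteq> Carrier A \<and>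
     (\<forall>l\<in>Ops \<Omega>. \<forall>x \<in> Arity \<Omega> l \<rightarrow>\<^sub>E Carrier S. Op S l x = Op A l x)"

text \<open>The algebra structure induced on a subset \<open>R\<close> closed under the operations.\<close>

definition restrict_alg ::
    "('l, 'i) optype \<Rightarrow> ('l, 'i, 'b) algebra \<Rightarrow> 'b set \<Rightarrow> ('l, 'i, 'b) algebra" where
  "restrict_alg \<Omega> A R =
     \<lparr>Carrier = R, Op = (\<lambda>l\<in>Ops \<Omega>. \<lambda>x \<in> Arity \<Omega> l \<rightarrow>\<^sub>E R. Op A l x)\<rparr>"

definition product_alg ::
    "('l, 'i) optype \<Rightarrow> 'j set \<Rightarrow> ('j \<Rightarrow> ('l, 'i, 'b) algebra) \<Rightarrow> ('l, 'i, 'j \<Rightarrow> 'b) algebra" where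
  "product_alg \<Omega> J A =
     \<lparr>Carrier = (\<Pi>\<^sub>E j\<in>J. Carrier (A j)),
      Op = (\<lambda>l\<in>Ops \<Omega>. \<lambda>x \<in> Arity \<Omega> l \<rightarrow>\<^sub>E (\<Pi>\<^sub>E j\<in>J. Carrier (A j)).
              \<lambda>j\<in>J. Op (A j) l (\<lambda>i\<in>Arity \<Omega> l. x i j))\<rparr>"

text \<open>The type \<open>'b\<close> plays the role of the universe from which the carriers of algebras are taken.
  The product of a family lives on the type \<open>'j \<Rightarrow> 'b\<close>, hence closure under products says that every
  algebra in the universe that is isomorphic to a product of members is a member. Index sets drawn
  from \<open>'b\<close> suffice: if \<open>P\<close> has a carrier in \<open>'b\<close> and is isomorphic to a product of nonempty
  algebras, then the factors with at least two elements are fewer than the elements of \<open>P\<close> (if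
  there are any), and one-element factors may be dropped; a product with an empty factor is that
  factor.\<close>

definition variety :: "('l, 'i) optype \<Rightarrow> ('l, 'i, 'b) algebra set \<Rightarrow> bool" where
  "variety \<Omega> V \<longleftrightarrow>
     (\<forall>A\<in>V. is_algebra \<Omega> A) \<and>
     (\<forall>(J :: 'b set) A P \<phi>. (\<forall>j\<in>J. A j \<in> V) \<and> is_algebra \<Omega> P \<and>
        \<phi> \<in> alg_hom \<Omega> (product_alg \<Omega> J A) P \<and>
        bij_betw \<phi> (Carrier (product_alg \<Omega> J A)) (Carrier P) \<longrightarrow> P \<in> V) \<and>
     (\<forall>A\<in>V. \<forall>S. subalgebra \<Omega> S A \<longrightarrow> S \<in> V) \<and>
     (\<forall>A\<in>V. \<forall>B \<phi>. is_algebra \<Omega> B \<and> \<phi> \<in> alg_hom \<Omega> A B \<and> \<phi> ` Carrier A = Carrier B \<longrightarrow> B \<in> V)"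

type_synonym ('l, 'i, 'b) alg_arr =
  "('l, 'i, 'b) algebra \<times> ('b \<Rightarrow> 'b) \<times> ('l, 'i, 'b) algebra"

definition alg_cat :: "('l, 'i) optype \<Rightarrow> ('l, 'i, 'b) algebra set \<Rightarrow>
    (('l, 'i, 'b) algebra, ('l, 'i, 'b) alg_arr) category" where
  "alg_cat \<Omega> V = triple_cat V (alg_hom \<Omega>) (\<lambda>A. \<lambda>x\<in>Carrier A. x) (\<lambda>A \<psi> \<phi>. compose (Carrier A) \<psi> \<phi>)"


section \<open>Affine spaces and affine systems\<close>

text \<open>An arrow \<open>\<phi> : B1 \<rightarrow> B2\<close> of the opposite of \<open>alg_cat \<Omega> V\<close> is a triple \<open>(B2, h, B1)\<close>, and
  \<open>mor \<phi> = h\<close> is the underlying map of the homomorphism \<open>\<phi>\<^sup>o\<^sup>p\<close> from \<open>B2\<close> to \<open>B1\<close>.\<close>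

type_synonym ('xo, 'xa, 'l, 'i, 'b) base_func =
  "('xo, 'xa, ('l, 'i, 'b) algebra, ('l, 'i, 'b) alg_arr) func"

type_synonym ('xo, 'l, 'i, 'b) space = "'xo \<times> ('l, 'i, 'b) algebra"
type_synonym ('xo, 'xa, 'l, 'i, 'b) space_arr =
  "('xo, 'l, 'i, 'b) space \<times> 'xa \<times> ('xo, 'l, 'i, 'b) space"

type_synonym ('xo, 'l, 'i, 'b) system = "'xo \<times> ('l, 'i, 'b) alg_arr \<times> ('l, 'i, 'b) algebra"
type_synonym ('xo, 'xa, 'l, 'i, 'b) system_arr =
  "('xo, 'l, 'i, 'b) system \<times> ('xa \<times> ('l, 'i, 'b) alg_arr) \<times> ('xo, 'l, 'i, 'b) system"

definition AfSpc :: "('l, 'i) optype \<Rightarrow> ('l, 'i, 'b) algebra set \<Rightarrow> ('xo, 'xa) category \<Rightarrow>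
    ('xo, 'xa, 'l, 'i, 'b) base_func \<Rightarrow>
    (('xo, 'l, 'i, 'b) space, ('xo, 'xa, 'l, 'i, 'b) space_arr) category" where
  "AfSpc \<Omega> V X T = triple_cat
     {(x, \<tau>). x \<in> Obj X \<and> \<tau> \<in> V \<and> subalgebra \<Omega> \<tau> (ObjMap T x)}
     (\<lambda>(x1, \<tau>1) (x2, \<tau>2). {f \<in> Hom X x1 x2. \<forall>\<alpha>\<in>Carrier \<tau>2. mor (ArrMap T f) \<alpha> \<in> Carrier \<tau>1})
     (\<lambda>(x, \<tau>). Ident X x)
     (\<lambda>_ g f. Comp X g f)"

definition AfSys :: "('l, 'i) optype \<Rightarrow> ('l, 'i, 'b) algebra set \<Rightarrow> ('xo, 'xa) category \<Rightarrow>
    ('xo, 'xa, 'l, 'i, 'b) base_func \<Rightarrow>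
    (('xo, 'l, 'i, 'b) system, ('xo, 'xa, 'l, 'i, 'b) system_arr) category" where
  "AfSys \<Omega> V X T = comma_cat X (op_cat (alg_cat \<Omega> V)) (op_cat (alg_cat \<Omega> V))
     T (id_func (op_cat (alg_cat \<Omega> V)))"

definition E_obj :: "('xo, 'xa, 'l, 'i, 'b) base_func \<Rightarrow>
    ('xo, 'l, 'i, 'b) space \<Rightarrow> ('xo, 'l, 'i, 'b) system" where
  "E_obj T = (\<lambda>(x, \<tau>). (x, (\<tau>, \<lambda>\<alpha>\<in>Carrier \<tau>. \<alpha>, ObjMap T x), \<tau>))"

definition E_func :: "('l, 'i) optype \<Rightarrow> ('l, 'i, 'b) algebra set \<Rightarrow> ('xo, 'xa) category \<Rightarrow>
    ('xo, 'xa, 'l, 'i, 'b) base_func \<Rightarrow>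
    (('xo, 'l, 'i, 'b) space, ('xo, 'xa, 'l, 'i, 'b) space_arr,
     ('xo, 'l, 'i, 'b) system, ('xo, 'xa, 'l, 'i, 'b) system_arr) func" where
  "E_func \<Omega> V X T =
     \<lparr>ObjMap = restrict (E_obj T) (Obj (AfSpc \<Omega> V X T)),
      ArrMap = restrict
        (\<lambda>((x1, \<tau>1), f, (x2, \<tau>2)).
           (E_obj T (x1, \<tau>1),
            (f, (\<tau>2, restrict (mor (ArrMap T f)) (Carrier \<tau>2), \<tau>1)),
            E_obj T (x2, \<tau>2)))
        (Arr (AfSpc \<Omega> V X T))\<rparr>"

definition Spat_obj :: "('l, 'i) optype \<Rightarrow> ('xo, 'xa, 'l, 'i, 'b) base_func \<Rightarrow>
    ('xo, 'l, 'i, 'b) system \<Rightarrow> ('xo, 'l, 'i, 'b) space" where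
  "Spat_obj \<Omega> T = (\<lambda>(x, \<kappa>, B). (x, restrict_alg \<Omega> (ObjMap T x) (mor \<kappa> ` Carrier B)))"

definition Spat_func :: "('l, 'i) optype \<Rightarrow> ('l, 'i, 'b) algebra set \<Rightarrow> ('xo, 'xa) category \<Rightarrow>
    ('xo, 'xa, 'l, 'i, 'b) base_func \<Rightarrow>
    (('xo, 'l, 'i, 'b) system, ('xo, 'xa, 'l, 'i, 'b) system_arr,
     ('xo, 'l, 'i, 'b) space, ('xo, 'xa, 'l, 'i, 'b) space_arr) func" where
  "Spat_func \<Omega> V X T =
     \<lparr>ObjMap = restrict (Spat_obj \<Omega> T) (Obj (AfSys \<Omega> V X T)),
      ArrMap = restrict (\<lambda>(s1, (f, \<phi>), s2). (Spat_obj \<Omega> T s1, f, Spat_obj \<Omega> T s2))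
        (Arr (AfSys \<Omega> V X T))\<rparr>"


section \<open>Institutions\<close>

text \<open>\<open>inst_cat D\<close> is the category of institutions valued in \<open>D\<close>. The abstract signatures of all
  institutions are taken from one pair of (arbitrary) types \<open>'s\<close>, \<open>'t\<close> of objects and arrows.\<close>

type_synonym ('s, 't, 'o, 'a) inst = "('s, 't) category \<times> ('s, 't, 'o, 'a) func"
type_synonym ('s, 't, 'o, 'a) inst_arr =
  "('s, 't, 'o, 'a) inst \<times> (('s, 't, 's, 't) func \<times> ('s \<Rightarrow> 'a)) \<times> ('s, 't, 'o, 'a) inst"

definition inst_cat :: "('o, 'a) category \<Rightarrow>
    (('s, 't, 'o, 'a) inst, ('s, 't, 'o, 'a) inst_arr) category" where
  "inst_cat D = triple_cat
     {(S, I). is_functor S D I}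
     (\<lambda>(S1, I1) (S2, I2).
        {(\<Phi>, \<alpha>). is_functor S1 S2 \<Phi> \<and> nat_trans S1 D I1 (comp_func S1 I2 \<Phi>) \<alpha>})
     (\<lambda>(S, I). (id_func S, id_nat S D I))
     (\<lambda>(S1, I1) (\<Phi>', \<alpha>') (\<Phi>, \<alpha>).
        (comp_func S1 \<Phi>' \<Phi>, comp_nat S1 D (whisker_right S1 \<alpha>' \<Phi>) \<alpha>))"

type_synonym ('s, 't, 'xo, 'xa, 'l, 'i, 'b) spatial_inst =
  "('s, 't, ('xo, 'l, 'i, 'b) space, ('xo, 'xa, 'l, 'i, 'b) space_arr) inst"
type_synonym ('s, 't, 'xo, 'xa, 'l, 'i, 'b) spatial_inst_arr =
  "('s, 't, ('xo, 'l, 'i, 'b) space, ('xo, 'xa, 'l, 'i, 'b) space_arr) inst_arr"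
type_synonym ('s, 't, 'xo, 'xa, 'l, 'i, 'b) affine_inst =
  "('s, 't, ('xo, 'l, 'i, 'b) system, ('xo, 'xa, 'l, 'i, 'b) system_arr) inst"
type_synonym ('s, 't, 'xo, 'xa, 'l, 'i, 'b) affine_inst_arr =
  "('s, 't, ('xo, 'l, 'i, 'b) system, ('xo, 'xa, 'l, 'i, 'b) system_arr) inst_arr"

definition SAfInst :: "('l, 'i) optype \<Rightarrow> ('l, 'i, 'b) algebra set \<Rightarrow> ('xo, 'xa) category \<Rightarrow>
    ('xo, 'xa, 'l, 'i, 'b) base_func \<Rightarrow>
    (('s, 't, 'xo, 'xa, 'l, 'i, 'b) spatial_inst,
     ('s, 't, 'xo, 'xa, 'l, 'i, 'b) spatial_inst_arr) category" where
  "SAfInst \<Omega> V X T = inst_cat (AfSpc \<Omega> V X T)"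

definition AfInst :: "('l, 'i) optype \<Rightarrow> ('l, 'i, 'b) algebra set \<Rightarrow> ('xo, 'xa) category \<Rightarrow>
    ('xo, 'xa, 'l, 'i, 'b) base_func \<Rightarrow>
    (('s, 't, 'xo, 'xa, 'l, 'i, 'b) affine_inst,
     ('s, 't, 'xo, 'xa, 'l, 'i, 'b) affine_inst_arr) category" where
  "AfInst \<Omega> V X T = inst_cat (AfSys \<Omega> V X T)"

definition IE :: "('l, 'i) optype \<Rightarrow> ('l, 'i, 'b) algebra set \<Rightarrow> ('xo, 'xa) category \<Rightarrow>
    ('xo, 'xa, 'l, 'i, 'b) base_func \<Rightarrow>
    (('s, 't, 'xo, 'xa, 'l, 'i, 'b) spatial_inst, ('s, 't, 'xo, 'xa, 'l, 'i, 'b) spatial_inst_arr,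
     ('s, 't, 'xo, 'xa, 'l, 'i, 'b) affine_inst, ('s, 't, 'xo, 'xa, 'l, 'i, 'b) affine_inst_arr)
    func" where
  "IE \<Omega> V X T =
     \<lparr>ObjMap = restrict (\<lambda>(S, I). (S, comp_func S (E_func \<Omega> V X T) I)) (Obj (SAfInst \<Omega> V X T)),
      ArrMap = restrict
        (\<lambda>((S1, I1), (\<Phi>, \<alpha>), (S2, I2)).
           ((S1, comp_func S1 (E_func \<Omega> V X T) I1),
            (\<Phi>, whisker_left S1 (E_func \<Omega> V X T) \<alpha>),
            (S2, comp_func S2 (E_func \<Omega> V X T) I2)))
        (Arr (SAfInst \<Omega> V X T))\<rparr>"

definition ISpat :: "('l, 'i) optype \<Rightarrow> ('l, 'i, 'b) algebra set \<Rightarrow> ('xo, 'xa) category \<Rightarrow>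
    ('xo, 'xa, 'l, 'i, 'b) base_func \<Rightarrow>
    (('s, 't, 'xo, 'xa, 'l, 'i, 'b) affine_inst, ('s, 't, 'xo, 'xa, 'l, 'i, 'b) affine_inst_arr,
     ('s, 't, 'xo, 'xa, 'l, 'i, 'b) spatial_inst, ('s, 't, 'xo, 'xa, 'l, 'i, 'b) spatial_inst_arr)
    func" where
  "ISpat \<Omega> V X T =
     \<lparr>ObjMap = restrict (\<lambda>(S, I). (S, comp_func S (Spat_func \<Omega> V X T) I)) (Obj (AfInst \<Omega> V X T)),
      ArrMap = restrict
        (\<lambda>((S1, I1), (\<Phi>, \<alpha>), (S2, I2)).
           ((S1, comp_func S1 (Spat_func \<Omega> V X T) I1),
            (\<Phi>, whisker_left S1 (Spat_func \<Omega> V X T) \<alpha>),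
            (S2, comp_func S2 (Spat_func \<Omega> V X T) I2)))
        (Arr (AfInst \<Omega> V X T))\<rparr>"

end

theory Submission
  imports Defs
begin

text \<open>
  All three claims are instances of one formal fact about a pair of functors \<open>F : C \<rightarrow> D\<close> and
  \<open>G : D \<rightarrow> C\<close> with \<open>GF = 1\<close>, together with a natural transformation \<open>\<epsilon> : FG \<rightarrow> 1\<close> for which \<open>\<epsilon>F\<close> and
  \<open>G\<epsilon>\<close> consist of identities; such data are called a strict coreflection below. The two conditions
  on \<open>\<epsilon>\<close> are exactly the triangle identities for the identity unit, so \<open>G\<close> is a right adjoint of \<open>F\<close>.
  From \<open>GF = 1\<close> one reads off that \<open>F\<close> is faithful and injective on objects, and naturality of \<open>\<epsilon>\<close> at
  \<open>g : Fa \<rightarrow> Fa'\<close>, where both components are identities, says \<open>FGg = g\<close>: so \<open>F\<close> is full. Finally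
  \<open>F\<close> is an isomorphism onto the full subcategory on its image, and \<open>FG\<close> together with the same \<open>\<epsilon>\<close>
  is a strict coreflection for the inclusion of that subcategory.

  Strict coreflections lift to institutions. Composition with a functor \<open>K : C \<rightarrow> D\<close> turns
  institutions valued in \<open>C\<close> into institutions valued in \<open>D\<close>, functorially in the institution and
  compatibly with identities and composites of such \<open>K\<close>; the counit at \<open>(S, I)\<close> is \<open>(1, \<epsilon>I)\<close>, and
  every equation that it has to satisfy holds pointwise because it does so for \<open>\<epsilon>\<close>
  (lemma \<open>inst_strict_coreflection\<close>).

  It remains to see that \<open>E\<close> and \<open>Spat\<close> form a strict coreflection
  (lemma \<open>spat_strict_coreflection\<close>). A subalgebra is the image of its own inclusion, whence
  \<open>Spat E = 1\<close>. For a system \<open>(x, \<kappa>, B)\<close> the homomorphism \<open>\<kappa>\<^sup>o\<^sup>p : B \<rightarrow> Tx\<close> corestricts to its image,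
  which lies in the variety as a subalgebra of \<open>Tx\<close>; this corestriction, read in the opposite
  category and paired with the identity of \<open>x\<close>, is the counit. It is an identity if \<open>\<kappa>\<^sup>o\<^sup>p\<close> is an
  inclusion, and \<open>Spat\<close>, which keeps only the first component, sends it to an identity in any case.
\<close>


section \<open>Categories, functors and natural transformations\<close>

lemma HomD:
  assumes "f \<in> Hom C a b"
  shows "f \<in> Arr C" "Dom C f = a" "Cod C f = b"
  using assms by (auto simp: Hom_def)

lemma (in category) Hom_Obj:
  assumes "f \<in> Hom C a b"
  shows "a \<in> Obj C" "b \<in> Obj C"
  using assms Dom_in Cod_in by (auto simp: Hom_def)

lemma (in category) Arr_Hom:
  assumes "f \<in> Arr C"
  shows "f \<in> Hom C (Dom C f) (Cod C f)"
  using assms by (auto simp: Hom_def)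

lemma Hom_op_cat: "Hom (op_cat C) a b = Hom C b a"
  by (auto simp: Hom_def op_cat_def)

lemma Obj_op_cat: "Obj (op_cat C) = Obj C"
  by (simp add: op_cat_def)

lemma Ident_op_cat: "Ident (op_cat C) = Ident C"
  by (simp add: op_cat_def)

lemma Comp_op_cat: "Comp (op_cat C) g f = Comp C f g"
  by (simp add: op_cat_def)

lemma category_op_cat:
  assumes "category C"
  shows "category (op_cat C)"
proof -
  interpret category C by fact
  show ?thesis
  proof (unfold_locales, unfold Hom_op_cat)
    show "Comp (op_cat C) g f = undefined"
      if "\<not> (f \<in> Arr (op_cat C) \<and> g \<in> Arr (op_cat C) \<and> Dom (op_cat C) g = Cod (op_cat C) f)"
      for f g
      using that Comp_ext[of g f] by (auto simp: op_cat_def)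
  qed (auto simp: op_cat_def Dom_in Cod_in Ident_ext Ident_in Comp_in Comp_Ident_left
      Comp_Ident_right Comp_assoc)
qed

lemma Hom_triple_cat:
  "u \<in> Hom (triple_cat Ob H i c) a b \<longleftrightarrow> (\<exists>m\<in>H a b. u = (a, m, b) \<and> a \<in> Ob \<and> b \<in> Ob)"
  by (auto simp: triple_cat_def Let_def Hom_def)

lemma Obj_triple_cat: "Obj (triple_cat Ob H i c) = Ob"
  by (simp add: triple_cat_def Let_def)

lemma Ident_triple_cat: "a \<in> Ob \<Longrightarrow> Ident (triple_cat Ob H i c) a = (a, i a, a)"
  by (simp add: triple_cat_def Let_def)

lemma Comp_triple_cat:
  assumes "(a, m, b) \<in> Hom (triple_cat Ob H i c) a b" "(b, n, d) \<in> Hom (triple_cat Ob H i c) b d"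
  shows "Comp (triple_cat Ob H i c) (b, n, d) (a, m, b) = (a, c a n m, d)"
  using assms by (auto simp: triple_cat_def Let_def Hom_def)

lemma category_triple_cat:
  assumes id: "\<And>a. a \<in> Ob \<Longrightarrow> i a \<in> H a a"
    and comp: "\<And>a b d m n. \<lbrakk>a \<in> Ob; b \<in> Ob; d \<in> Ob; m \<in> H a b; n \<in> H b d\<rbrakk> \<Longrightarrow> c a n m \<in> H a d"
    and left: "\<And>a b m. \<lbrakk>a \<in> Ob; b \<in> Ob; m \<in> H a b\<rbrakk> \<Longrightarrow> c a (i b) m = m"
    and right: "\<And>a b m. \<lbrakk>a \<in> Ob; b \<in> Ob; m \<in> H a b\<rbrakk> \<Longrightarrow> c a m (i a) = m"
    and assoc: "\<And>a b d e m n p. \<lbrakk>a \<in> Ob; b \<in> Ob; d \<in> Ob; e \<in> Ob; m \<in> H a b; n \<in> H b d; p \<in> H d e\<rbrakk>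
      \<Longrightarrow> c a p (c a n m) = c a (c b p n) m"
  shows "category (triple_cat Ob H i c)"
proof -
  let ?C = "triple_cat Ob H i c"
  show ?thesis
  proof
    show "Dom ?C \<in> Arr ?C \<rightarrow>\<^sub>E Obj ?C" "Cod ?C \<in> Arr ?C \<rightarrow>\<^sub>E Obj ?C" "Ident ?C \<in> extensional (Obj ?C)"
      by (auto simp: triple_cat_def Let_def)
    show "Comp ?C g f = undefined"
      if "\<not> (f \<in> Arr ?C \<and> g \<in> Arr ?C \<and> Dom ?C g = Cod ?C f)" for f g
      using that by (auto simp: triple_cat_def Let_def)
    show "Ident ?C a \<in> Hom ?C a a" if "a \<in> Obj ?C" for a
      using that id by (simp add: Obj_triple_cat Ident_triple_cat Hom_triple_cat)
    show "Comp ?C g f \<in> Hom ?C a d" if f: "f \<in> Hom ?C a b" and g: "g \<in> Hom ?C b d" for a b d f g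
    proof -
      obtain m n where "f = (a, m, b)" "g = (b, n, d)" using f g by (auto simp: Hom_triple_cat)
      with f g comp show ?thesis by (simp add: Comp_triple_cat) (auto simp: Hom_triple_cat)
    qed
    show "Comp ?C (Ident ?C b) f = f" "Comp ?C f (Ident ?C a) = f" if f: "f \<in> Hom ?C a b" for a b f
      using f id left right
      by (auto simp: Hom_triple_cat Ident_triple_cat Comp_triple_cat)
    show "Comp ?C h (Comp ?C g f) = Comp ?C (Comp ?C h g) f"
      if "f \<in> Hom ?C a b" "g \<in> Hom ?C b d" "h \<in> Hom ?C d e" for a b d e f g h
      using that comp assoc by (auto simp: Hom_triple_cat Comp_triple_cat)
  qed
qed

lemma is_functorI:
  assumes "category C" "category D" "ObjMap F \<in> Obj C \<rightarrow>\<^sub>E Obj D" "ArrMap F \<in> extensional (Arr C)"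
    and "\<And>a b f. f \<in> Hom C a b \<Longrightarrow> ArrMap F f \<in> Hom D (ObjMap F a) (ObjMap F b)"
    and "\<And>a. a \<in> Obj C \<Longrightarrow> ArrMap F (Ident C a) = Ident D (ObjMap F a)"
    and "\<And>a b c f g. f \<in> Hom C a b \<Longrightarrow> g \<in> Hom C b c \<Longrightarrow>
      ArrMap F (Comp C g f) = Comp D (ArrMap F g) (ArrMap F f)"
  shows "is_functor C D F"
  unfolding is_functor_def using assms by (auto simp: Hom_def)

lemma functorD:
  assumes "is_functor C D F"
  shows functor_dom: "category C" and functor_cod: "category D"
    and functor_Obj: "a \<in> Obj C \<Longrightarrow> ObjMap F a \<in> Obj D"
    and functor_Obj_ext: "ObjMap F \<in> Obj C \<rightarrow>\<^sub>E Obj D"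
    and functor_Arr_ext: "ArrMap F \<in> extensional (Arr C)"
    and functor_Hom: "f \<in> Hom C a b \<Longrightarrow> ArrMap F f \<in> Hom D (ObjMap F a) (ObjMap F b)"
    and functor_Ident: "a \<in> Obj C \<Longrightarrow> ArrMap F (Ident C a) = Ident D (ObjMap F a)"
    and functor_Comp: "f \<in> Hom C a b \<Longrightarrow> g \<in> Hom C b c \<Longrightarrow>
      ArrMap F (Comp C g f) = Comp D (ArrMap F g) (ArrMap F f)"
  using assms category.Hom_Obj[of C f a b]
  by (auto simp: is_functor_def) (auto simp: Hom_def)

lemma functor_Arr:
  assumes "is_functor C D F" "f \<in> Arr C"
  shows "ArrMap F f \<in> Arr D"
  using functor_Hom[OF assms(1) category.Arr_Hom[OF functor_dom[OF assms(1)] assms(2)]]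
  by (rule HomD)

lemma functor_eqI:
  fixes F G :: "('o1, 'a1, 'o2, 'a2) func"
  assumes "ObjMap F \<in> extensional (Obj C)" "ObjMap G \<in> extensional (Obj C)"
    and "ArrMap F \<in> extensional (Arr C)" "ArrMap G \<in> extensional (Arr C)"
    and "\<And>a. a \<in> Obj C \<Longrightarrow> ObjMap F a = ObjMap G a"
    and "\<And>f. f \<in> Arr C \<Longrightarrow> ArrMap F f = ArrMap G f"
  shows "F = G"
proof -
  have "ObjMap F = ObjMap G" "ArrMap F = ArrMap G"
    using assms by (auto intro: extensionalityI)
  then show ?thesis by simp
qed

lemma ObjMap_id_func: "a \<in> Obj C \<Longrightarrow> ObjMap (id_func C) a = a"
  by (simp add: id_func_def)

lemma ArrMap_id_func: "f \<in> Arr C \<Longrightarrow> ArrMap (id_func C) f = f"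
  by (simp add: id_func_def)

lemma ObjMap_comp_func: "a \<in> Obj C \<Longrightarrow> ObjMap (comp_func C G F) a = ObjMap G (ObjMap F a)"
  by (simp add: comp_func_def compose_eq)

lemma ArrMap_comp_func: "f \<in> Arr C \<Longrightarrow> ArrMap (comp_func C G F) f = ArrMap G (ArrMap F f)"
  by (simp add: comp_func_def compose_eq)

lemmas func_apply = ObjMap_id_func ArrMap_id_func ObjMap_comp_func ArrMap_comp_func

lemma is_functor_id_func:
  assumes "category C"
  shows "is_functor C C (id_func C)"
proof -
  interpret category C by fact
  show ?thesis
  proof (rule is_functorI)
    fix a b f assume f: "f \<in> Hom C a b"
    then show "ArrMap (id_func C) f \<in> Hom C (ObjMap (id_func C) a) (ObjMap (id_func C) b)"
      using Hom_Obj[OF f] by (simp add: func_apply HomD[OF f])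
  next
    fix a assume "a \<in> Obj C"
    then show "ArrMap (id_func C) (Ident C a) = Ident C (ObjMap (id_func C) a)"
      using HomD(1)[OF Ident_in] by (simp add: func_apply)
  next
    fix a b c f g assume fg: "f \<in> Hom C a b" "g \<in> Hom C b c"
    show "ArrMap (id_func C) (Comp C g f) = Comp C (ArrMap (id_func C) g) (ArrMap (id_func C) f)"
      using HomD(1)[OF Comp_in[OF fg]] HomD(1)[OF fg(1)] HomD(1)[OF fg(2)]
      by (simp add: func_apply)
  qed (auto simp: id_func_def assms)
qed

lemma is_functor_comp_func:
  assumes F: "is_functor C D F" and G: "is_functor D E G"
  shows "is_functor C E (comp_func C G F)"
proof -
  interpret category C using F by (rule functor_dom)
  show ?thesis
  proof (rule is_functorI)
    show "category C" by unfold_locales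
    show "category E" using G by (rule functor_cod)
    show "ObjMap (comp_func C G F) \<in> Obj C \<rightarrow>\<^sub>E Obj E"
      using functor_Obj[OF G functor_Obj[OF F]] by (auto simp: comp_func_def compose_def)
    show "ArrMap (comp_func C G F) \<in> extensional (Arr C)"
      by (simp add: comp_func_def)
  next
    fix a b f assume f: "f \<in> Hom C a b"
    show "ArrMap (comp_func C G F) f
        \<in> Hom E (ObjMap (comp_func C G F) a) (ObjMap (comp_func C G F) b)"
      using functor_Hom[OF G functor_Hom[OF F f]] Hom_Obj[OF f] HomD(1)[OF f]
      by (simp add: func_apply)
  next
    fix a assume a: "a \<in> Obj C"
    show "ArrMap (comp_func C G F) (Ident C a) = Ident E (ObjMap (comp_func C G F) a)"
      using HomD(1)[OF Ident_in[OF a]] a functor_Obj[OF F a]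
      by (simp add: func_apply functor_Ident[OF F] functor_Ident[OF G])
  next
    fix a b c f g assume fg: "f \<in> Hom C a b" "g \<in> Hom C b c"
    show "ArrMap (comp_func C G F) (Comp C g f)
        = Comp E (ArrMap (comp_func C G F) g) (ArrMap (comp_func C G F) f)"
      using HomD(1)[OF Comp_in[OF fg]] HomD(1)[OF fg(1)] HomD(1)[OF fg(2)]
      by (simp add: func_apply functor_Comp[OF F fg]
          functor_Comp[OF G functor_Hom[OF F fg(1)] functor_Hom[OF F fg(2)]])
  qed
qed

lemma comp_func_assoc:
  assumes "is_functor B C F"
  shows "comp_func B (comp_func C H G) F = comp_func B H (comp_func B G F)"
proof -
  have "ArrMap F \<in> Arr B \<rightarrow> Arr C" "ObjMap F \<in> Obj B \<rightarrow> Obj C"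
    using functor_Arr[OF assms] functor_Obj[OF assms] by auto
  then show ?thesis
    by (auto simp: comp_func_def compose_def fun_eq_iff)
qed

lemma comp_func_id_left:
  assumes "is_functor C D F"
  shows "comp_func C (id_func D) F = F"
  by (rule functor_eqI[where C = C])
    (use assms functor_Obj[OF assms] functor_Arr[OF assms] functor_Obj_ext[OF assms]
      functor_Arr_ext[OF assms]
      in \<open>auto simp: PiE_def func_apply\<close>, simp_all add: comp_func_def)

lemma comp_func_id_right:
  assumes "is_functor C D F"
  shows "comp_func C F (id_func C) = F"
  by (rule functor_eqI[where C = C])
    (use assms functor_Obj_ext[OF assms] functor_Arr_ext[OF assms]
      in \<open>auto simp: PiE_def func_apply\<close>, simp_all add: comp_func_def)

lemma nat_transI:
  assumes "is_functor C D F" "is_functor C D G" "\<alpha> \<in> extensional (Obj C)"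
    and "\<And>a. a \<in> Obj C \<Longrightarrow> \<alpha> a \<in> Hom D (ObjMap F a) (ObjMap G a)"
    and "\<And>a b f. f \<in> Hom C a b \<Longrightarrow>
      Comp D (\<alpha> b) (ArrMap F f) = Comp D (ArrMap G f) (\<alpha> a)"
  shows "nat_trans C D F G \<alpha>"
  unfolding nat_trans_def using assms by auto

lemma nat_transD:
  assumes "nat_trans C D F G \<alpha>"
  shows nat_trans_dom: "is_functor C D F" and nat_trans_cod: "is_functor C D G"
    and nat_trans_ext: "\<alpha> \<in> extensional (Obj C)"
    and nat_trans_Hom: "a \<in> Obj C \<Longrightarrow> \<alpha> a \<in> Hom D (ObjMap F a) (ObjMap G a)"
    and nat_trans_natural: "f \<in> Hom C a b \<Longrightarrow>
      Comp D (\<alpha> b) (ArrMap F f) = Comp D (ArrMap G f) (\<alpha> a)"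
  using assms category.Hom_Obj[OF functor_dom, of C D F f a b]
  by (auto simp: nat_trans_def)

lemma nat_trans_id_nat:
  assumes F: "is_functor C D F"
  shows "nat_trans C D F F (id_nat C D F)"
proof (rule nat_transI[OF F F])
  interpret C: category C using F by (rule functor_dom)
  interpret D: category D using F by (rule functor_cod)
  show "id_nat C D F \<in> extensional (Obj C)" by (simp add: id_nat_def)
  show "id_nat C D F a \<in> Hom D (ObjMap F a) (ObjMap F a)" if "a \<in> Obj C" for a
    using that D.Ident_in[OF functor_Obj[OF F]] by (simp add: id_nat_def)
  show "Comp D (id_nat C D F b) (ArrMap F f) = Comp D (ArrMap F f) (id_nat C D F a)"
    if f: "f \<in> Hom C a b" for a b f
    using C.Hom_Obj[OF f] functor_Hom[OF F f]
    by (simp add: id_nat_def D.Comp_Ident_left D.Comp_Ident_right)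
qed

lemma nat_trans_comp_nat:
  assumes \<alpha>: "nat_trans C D F G \<alpha>" and \<beta>: "nat_trans C D G H \<beta>"
  shows "nat_trans C D F H (comp_nat C D \<beta> \<alpha>)"
proof (rule nat_transI)
  show F: "is_functor C D F" and H: "is_functor C D H"
    using nat_trans_dom[OF \<alpha>] nat_trans_cod[OF \<beta>] .
  interpret C: category C using F by (rule functor_dom)
  interpret D: category D using F by (rule functor_cod)
  show "comp_nat C D \<beta> \<alpha> \<in> extensional (Obj C)" by (simp add: comp_nat_def)
  show "comp_nat C D \<beta> \<alpha> a \<in> Hom D (ObjMap F a) (ObjMap H a)" if "a \<in> Obj C" for a
    using that D.Comp_in[OF nat_trans_Hom[OF \<alpha>] nat_trans_Hom[OF \<beta>]] by (simp add: comp_nat_def)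
  show "Comp D (comp_nat C D \<beta> \<alpha> b) (ArrMap F f) = Comp D (ArrMap H f) (comp_nat C D \<beta> \<alpha> a)"
    if f: "f \<in> Hom C a b" for a b f
  proof -
    note ab = C.Hom_Obj[OF f] and F_f = functor_Hom[OF F f] and H_f = functor_Hom[OF H f]
    note G_f = functor_Hom[OF nat_trans_cod[OF \<alpha>] f]
    note \<alpha>a = nat_trans_Hom[OF \<alpha> ab(1)] and \<alpha>b = nat_trans_Hom[OF \<alpha> ab(2)]
    note \<beta>a = nat_trans_Hom[OF \<beta> ab(1)] and \<beta>b = nat_trans_Hom[OF \<beta> ab(2)]
    have "Comp D (Comp D (\<beta> b) (\<alpha> b)) (ArrMap F f) = Comp D (\<beta> b) (Comp D (ArrMap G f) (\<alpha> a))"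
      using D.Comp_assoc[OF F_f \<alpha>b \<beta>b] nat_trans_natural[OF \<alpha> f] by simp
    also have "\<dots> = Comp D (Comp D (ArrMap H f) (\<beta> a)) (\<alpha> a)"
      using D.Comp_assoc[OF \<alpha>a G_f \<beta>b] nat_trans_natural[OF \<beta> f] by simp
    also have "\<dots> = Comp D (ArrMap H f) (Comp D (\<beta> a) (\<alpha> a))"
      using D.Comp_assoc[OF \<alpha>a \<beta>a H_f] by simp
    finally show ?thesis using ab by (simp add: comp_nat_def)
  qed
qed

lemma nat_trans_whisker_left:
  assumes \<alpha>: "nat_trans B C F G \<alpha>" and K: "is_functor C D K"
  shows "nat_trans B D (comp_func B K F) (comp_func B K G) (whisker_left B K \<alpha>)"
proof (rule nat_transI)
  note F = nat_trans_dom[OF \<alpha>] and G = nat_trans_cod[OF \<alpha>]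
  interpret B: category B using F by (rule functor_dom)
  show "is_functor B D (comp_func B K F)" "is_functor B D (comp_func B K G)"
    using F G K by (auto intro: is_functor_comp_func)
  show "whisker_left B K \<alpha> \<in> extensional (Obj B)" by (simp add: whisker_left_def)
  show "whisker_left B K \<alpha> a \<in> Hom D (ObjMap (comp_func B K F) a) (ObjMap (comp_func B K G) a)"
    if "a \<in> Obj B" for a
    using that functor_Hom[OF K nat_trans_Hom[OF \<alpha> that]] by (simp add: whisker_left_def func_apply)
  show "Comp D (whisker_left B K \<alpha> b) (ArrMap (comp_func B K F) f)
      = Comp D (ArrMap (comp_func B K G) f) (whisker_left B K \<alpha> a)" if f: "f \<in> Hom B a b" for a b f
  proof -
    note ab = B.Hom_Obj[OF f]
    show ?thesis
      using functor_Comp[OF K functor_Hom[OF F f] nat_trans_Hom[OF \<alpha> ab(2)]]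
        functor_Comp[OF K nat_trans_Hom[OF \<alpha> ab(1)] functor_Hom[OF G f]]
        nat_trans_natural[OF \<alpha> f] ab HomD(1)[OF f]
      by (simp add: whisker_left_def func_apply)
  qed
qed

lemma nat_trans_whisker_right:
  assumes \<alpha>: "nat_trans C D F G \<alpha>" and K: "is_functor B C K"
  shows "nat_trans B D (comp_func B F K) (comp_func B G K) (whisker_right B \<alpha> K)"
proof (rule nat_transI)
  note F = nat_trans_dom[OF \<alpha>] and G = nat_trans_cod[OF \<alpha>]
  interpret B: category B using K by (rule functor_dom)
  show "is_functor B D (comp_func B F K)" "is_functor B D (comp_func B G K)"
    using F G K by (auto intro: is_functor_comp_func)
  show "whisker_right B \<alpha> K \<in> extensional (Obj B)" by (simp add: whisker_right_def)
  show "whisker_right B \<alpha> K a \<in> Hom D (ObjMap (comp_func B F K) a) (ObjMap (comp_func B G K) a)"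
    if "a \<in> Obj B" for a
    using that nat_trans_Hom[OF \<alpha> functor_Obj[OF K that]]
    by (simp add: whisker_right_def func_apply)
  show "Comp D (whisker_right B \<alpha> K b) (ArrMap (comp_func B F K) f)
      = Comp D (ArrMap (comp_func B G K) f) (whisker_right B \<alpha> K a)"
    if f: "f \<in> Hom B a b" for a b f
    using nat_trans_natural[OF \<alpha> functor_Hom[OF K f]] B.Hom_Obj[OF f] HomD(1)[OF f]
    by (simp add: whisker_right_def func_apply)
qed

lemma Obj_comma_cat:
  "(a, h, b) \<in> Obj (comma_cat A B C F G) \<longleftrightarrow>
    a \<in> Obj A \<and> b \<in> Obj B \<and> h \<in> Hom C (ObjMap F a) (ObjMap G b)"
  by (simp add: comma_cat_def Obj_triple_cat)

lemma Hom_comma_cat: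
  "u \<in> Hom (comma_cat A B C F G) (a1, h1, b1) (a2, h2, b2) \<longleftrightarrow>
    (a1, h1, b1) \<in> Obj (comma_cat A B C F G) \<and> (a2, h2, b2) \<in> Obj (comma_cat A B C F G) \<and>
    (\<exists>f g. u = ((a1, h1, b1), (f, g), (a2, h2, b2)) \<and> f \<in> Hom A a1 a2 \<and> g \<in> Hom B b1 b2 \<and>
      Comp C h2 (ArrMap F f) = Comp C (ArrMap G g) h1)"
  by (auto simp: comma_cat_def Obj_triple_cat Hom_triple_cat)

lemma Ident_comma_cat:
  assumes "(a, h, b) \<in> Obj (comma_cat A B C F G)"
  shows "Ident (comma_cat A B C F G) (a, h, b) = ((a, h, b), (Ident A a, Ident B b), (a, h, b))"
  using assms by (simp add: comma_cat_def Obj_triple_cat Ident_triple_cat)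

lemma Comp_comma_cat:
  assumes "(s1, (f, g), s2) \<in> Hom (comma_cat A B C F G) s1 s2"
    and "(s2, (f', g'), s3) \<in> Hom (comma_cat A B C F G) s2 s3"
  shows "Comp (comma_cat A B C F G) (s2, (f', g'), s3) (s1, (f, g), s2) =
    (s1, (Comp A f' f, Comp B g' g), s3)"
  using Comp_triple_cat[OF assms[unfolded comma_cat_def]] by (simp add: comma_cat_def)

lemma category_comma_cat:
  assumes F: "is_functor A C F" and G: "is_functor B C G"
  shows "category (comma_cat A B C F G)"
proof -
  interpret A: category A using F by (rule functor_dom)
  interpret B: category B using G by (rule functor_dom)
  interpret C: category C using F by (rule functor_cod)
  show ?thesis
    unfolding comma_cat_def
  proof (rule category_triple_cat, goal_cases)
    case (1 s)
    then show ?case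
      by (auto simp: A.Ident_in B.Ident_in functor_Ident[OF F] functor_Ident[OF G]
          C.Comp_Ident_left C.Comp_Ident_right)
  next
    case (2 s1 s2 s3 m n)
    obtain a1 h1 b1 a2 h2 b2 a3 h3 b3 f g f' g' where
      eqs: "s1 = (a1, h1, b1)" "s2 = (a2, h2, b2)" "s3 = (a3, h3, b3)" "m = (f, g)" "n = (f', g')"
      by (metis surj_pair)
    with 2 have h1: "h1 \<in> Hom C (ObjMap F a1) (ObjMap G b1)"
      and h2: "h2 \<in> Hom C (ObjMap F a2) (ObjMap G b2)"
      and h3: "h3 \<in> Hom C (ObjMap F a3) (ObjMap G b3)"
      and f: "f \<in> Hom A a1 a2" and g: "g \<in> Hom B b1 b2"
      and f': "f' \<in> Hom A a2 a3" and g': "g' \<in> Hom B b2 b3"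
      and sq: "Comp C h2 (ArrMap F f) = Comp C (ArrMap G g) h1"
      and sq': "Comp C h3 (ArrMap F f') = Comp C (ArrMap G g') h2" by auto
    have "Comp C h3 (ArrMap F (Comp A f' f)) = Comp C (Comp C (ArrMap G g') h2) (ArrMap F f)"
      using C.Comp_assoc[OF functor_Hom[OF F f] functor_Hom[OF F f'] h3] sq'
      by (simp add: functor_Comp[OF F f f'])
    also have "\<dots> = Comp C (ArrMap G g') (Comp C (ArrMap G g) h1)"
      using C.Comp_assoc[OF functor_Hom[OF F f] h2 functor_Hom[OF G g']] sq by simp
    also have "\<dots> = Comp C (ArrMap G (Comp B g' g)) h1"
      using C.Comp_assoc[OF h1 functor_Hom[OF G g] functor_Hom[OF G g']]
      by (simp add: functor_Comp[OF G g g'])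
    finally show ?case using A.Comp_in[OF f f'] B.Comp_in[OF g g'] by (simp add: eqs)
  qed (auto simp: A.Comp_Ident_left A.Comp_Ident_right B.Comp_Ident_left B.Comp_Ident_right
      A.Comp_assoc B.Comp_assoc)
qed


section \<open>Strict coreflections\<close>

text \<open>An adjunction exhibiting \<open>C\<close> as coreflective in \<open>D\<close>, with the identity as its unit. The last two conditions are what the
  triangle identities become in that case.\<close>

locale strict_coreflection =
  fixes C :: "('o1, 'a1) category" and D :: "('o2, 'a2) category"
    and F :: "('o1, 'a1, 'o2, 'a2) func" and G :: "('o2, 'a2, 'o1, 'a1) func"
    and \<epsilon> :: "'o2 \<Rightarrow> 'a2"
  assumes F: "is_functor C D F"
    and G: "is_functor D C G"
    and left_inverse: "comp_func C G F = id_func C"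
    and counit: "nat_trans D D (comp_func D F G) (id_func D) \<epsilon>"
    and counit_F: "a \<in> Obj C \<Longrightarrow> \<epsilon> (ObjMap F a) = Ident D (ObjMap F a)"
    and G_counit: "b \<in> Obj D \<Longrightarrow> ArrMap G (\<epsilon> b) = Ident C (ObjMap G b)"
begin

sublocale C: category C using F by (rule functor_dom)
sublocale D: category D using F by (rule functor_cod)

lemma GF_Obj: "a \<in> Obj C \<Longrightarrow> ObjMap G (ObjMap F a) = a"
  using ObjMap_comp_func[of a C G F] by (simp add: left_inverse func_apply)

lemma GF_Arr: "f \<in> Arr C \<Longrightarrow> ArrMap G (ArrMap F f) = f"
  using ArrMap_comp_func[of f C G F] by (simp add: left_inverse func_apply)

lemma counit_Hom: "b \<in> Obj D \<Longrightarrow> \<epsilon> b \<in> Hom D (ObjMap F (ObjMap G b)) b"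
  using nat_trans_Hom[OF counit, of b] by (simp add: func_apply)

lemma counit_natural:
  assumes "g \<in> Hom D b b'"
  shows "Comp D (\<epsilon> b') (ArrMap F (ArrMap G g)) = Comp D g (\<epsilon> b)"
  using nat_trans_natural[OF counit assms] HomD(1)[OF assms] by (simp add: func_apply)

text \<open>Fullness of \<open>F\<close>: at an arrow between objects in the image of \<open>F\<close>, both components of \<open>\<epsilon>\<close> in
  the naturality square are identities, so the square degenerates to an equation.\<close>

lemma FG_Arr:
  assumes "a \<in> Obj C" "a' \<in> Obj C" and g: "g \<in> Hom D (ObjMap F a) (ObjMap F a')"
  shows "ArrMap F (ArrMap G g) = g"
proof -
  have "ArrMap F (ArrMap G g) \<in> Hom D (ObjMap F a) (ObjMap F a')"
    using functor_Hom[OF F functor_Hom[OF G g]] assms by (simp add: GF_Obj)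
  then show ?thesis
    using counit_natural[OF g] assms
    by (simp add: counit_F D.Comp_Ident_left[OF g] D.Comp_Ident_right[OF g] D.Comp_Ident_left)
qed

lemma full_embedding: "full_embedding C D F"
  unfolding full_embedding_def
proof (intro conjI ballI)
  show "is_functor C D F" by (rule F)
  show "inj_on (ObjMap F) (Obj C)"
    by (rule inj_on_inverseI[of _ "ObjMap G"]) (rule GF_Obj)
  fix a b assume a: "a \<in> Obj C" and b: "b \<in> Obj C"
  show "inj_on (ArrMap F) (Hom C a b)"
    by (rule inj_on_inverseI[of _ "ArrMap G"]) (auto intro: GF_Arr dest: HomD)
  fix g assume g: "g \<in> Hom D (ObjMap F a) (ObjMap F b)"
  have "ArrMap G g \<in> Hom C a b"
    using functor_Hom[OF G g] a b by (simp add: GF_Obj)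
  then show "\<exists>f\<in>Hom C a b. ArrMap F f = g" using FG_Arr[OF a b g] by blast
qed

lemma right_adjoint_left_inverse: "right_adjoint_left_inverse C D F G"
  unfolding right_adjoint_left_inverse_def right_adjoint_def
proof (intro conjI exI ballI)
  show "nat_trans C C (id_func C) (comp_func C G F) (id_nat C C (id_func C))"
    unfolding left_inverse by (rule nat_trans_id_nat[OF is_functor_id_func[OF C.category_axioms]])
  show "Comp D (\<epsilon> (ObjMap F a)) (ArrMap F (id_nat C C (id_func C) a)) = Ident D (ObjMap F a)"
    if a: "a \<in> Obj C" for a
    using a D.Comp_Ident_left[OF D.Ident_in[OF functor_Obj[OF F a]]]
    by (simp add: id_nat_def func_apply counit_F functor_Ident[OF F])
  show "Comp C (ArrMap G (\<epsilon> b)) (id_nat C C (id_func C) (ObjMap G b)) = Ident C (ObjMap G b)"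
    if b: "b \<in> Obj D" for b
    using functor_Obj[OF G b] b C.Comp_Ident_left[OF C.Ident_in[OF functor_Obj[OF G b]]]
    by (simp add: id_nat_def func_apply G_counit)
qed (rule F G counit left_inverse)+

end

text \<open>Domains, codomains, identities and composites are cut down to the smaller sets because a
  category has to be undefined elsewhere.\<close>

definition full_subcat_on :: "('o, 'a) category \<Rightarrow> 'o set \<Rightarrow> ('o, 'a) category" where
  "full_subcat_on D Ob =
    (let Ar = {f \<in> Arr D. Dom D f \<in> Ob \<and> Cod D f \<in> Ob} in
     \<lparr>Obj = Ob, Arr = Ar, Dom = restrict (Dom D) Ar, Cod = restrict (Cod D) Ar,
      Ident = restrict (Ident D) Ob,
      Comp = (\<lambda>g f. if f \<in> Ar \<and> g \<in> Ar \<and> Dom D g = Cod D f then Comp D g f else undefined)\<rparr>)"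

lemma Hom_full_subcat_on:
  "f \<in> Hom (full_subcat_on D Ob) a b \<longleftrightarrow> f \<in> Hom D a b \<and> a \<in> Ob \<and> b \<in> Ob"
  by (auto simp: full_subcat_on_def Let_def Hom_def)

lemma Obj_full_subcat_on: "Obj (full_subcat_on D Ob) = Ob"
  by (simp add: full_subcat_on_def Let_def)

lemma Arr_full_subcat_on:
  "Arr (full_subcat_on D Ob) = {f \<in> Arr D. Dom D f \<in> Ob \<and> Cod D f \<in> Ob}"
  by (simp add: full_subcat_on_def Let_def)

lemma Ident_full_subcat_on: "a \<in> Ob \<Longrightarrow> Ident (full_subcat_on D Ob) a = Ident D a"
  by (simp add: full_subcat_on_def Let_def)

lemma Comp_full_subcat_on:
  assumes "f \<in> Hom (full_subcat_on D Ob) a b" "g \<in> Hom (full_subcat_on D Ob) b c"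
  shows "Comp (full_subcat_on D Ob) g f = Comp D g f"
  using assms unfolding Hom_full_subcat_on by (auto simp: full_subcat_on_def Let_def Hom_def)

lemma category_full_subcat_on:
  assumes "category D" "Ob \<subseteq> Obj D"
  shows "category (full_subcat_on D Ob)"
proof -
  interpret category D by fact
  let ?S = "full_subcat_on D Ob"
  have Comp_Hom: "Comp ?S g f \<in> Hom ?S a c" if "f \<in> Hom ?S a b" "g \<in> Hom ?S b c" for a b c f g
    using that Comp_full_subcat_on[OF that] Comp_in[of f a b g c] by (simp add: Hom_full_subcat_on)
  have Ident_Hom: "Ident ?S a \<in> Hom ?S a a" if "a \<in> Ob" for a
    using that assms(2) Ident_in by (auto simp: Hom_full_subcat_on Ident_full_subcat_on)
  show ?thesis
  proof
    show "Dom ?S \<in> Arr ?S \<rightarrow>\<^sub>E Obj ?S" "Cod ?S \<in> Arr ?S \<rightarrow>\<^sub>E Obj ?S" "Ident ?S \<in> extensional (Obj ?S)"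
      by (auto simp: full_subcat_on_def Let_def)
    show "Comp ?S g f = undefined"
      if "\<not> (f \<in> Arr ?S \<and> g \<in> Arr ?S \<and> Dom ?S g = Cod ?S f)" for f g
      using that by (auto simp: full_subcat_on_def Let_def)
    show "Ident ?S a \<in> Hom ?S a a" if "a \<in> Obj ?S" for a
      using that Ident_Hom by (simp add: Obj_full_subcat_on)
    show "Comp ?S g f \<in> Hom ?S a c" if "f \<in> Hom ?S a b" "g \<in> Hom ?S b c" for a b c f g
      using Comp_Hom[OF that] .
    show "Comp ?S (Ident ?S b) f = f" if f: "f \<in> Hom ?S a b" for a b f
    proof -
      have "b \<in> Ob" using f by (simp add: Hom_full_subcat_on)
      then show ?thesis
        using Comp_full_subcat_on[OF f Ident_Hom] f Comp_Ident_left[of f a b]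
        by (simp add: Hom_full_subcat_on Ident_full_subcat_on)
    qed
    show "Comp ?S f (Ident ?S a) = f" if f: "f \<in> Hom ?S a b" for a b f
    proof -
      have "a \<in> Ob" using f by (simp add: Hom_full_subcat_on)
      then show ?thesis
        using Comp_full_subcat_on[OF Ident_Hom f] f Comp_Ident_right[of f a b]
        by (simp add: Hom_full_subcat_on Ident_full_subcat_on)
    qed
    show "Comp ?S h (Comp ?S g f) = Comp ?S (Comp ?S h g) f"
      if "f \<in> Hom ?S a b" "g \<in> Hom ?S b c" "h \<in> Hom ?S c d" for a b c d f g h
      using that Comp_full_subcat_on[OF that(1) Comp_Hom[OF that(2,3)]]
        Comp_full_subcat_on[OF Comp_Hom[OF that(1,2)] that(3)]
        Comp_full_subcat_on[OF that(1,2)] Comp_full_subcat_on[OF that(2,3)]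
        Comp_assoc[of f a b g c h d]
      by (simp add: Hom_full_subcat_on)
  qed
qed

lemma full_subcategory_full_subcat_on:
  assumes "category D" "Ob \<subseteq> Obj D"
  shows "full_subcategory (full_subcat_on D Ob) D"
  unfolding full_subcategory_def using assms category_full_subcat_on[OF assms]
  by (auto simp: Hom_full_subcat_on full_subcat_on_def Let_def Hom_def)

lemma is_functor_into_full_subcat:
  assumes F: "is_functor C D F" and Ob: "Ob \<subseteq> Obj D" "\<And>a. a \<in> Obj C \<Longrightarrow> ObjMap F a \<in> Ob"
  shows "is_functor C (full_subcat_on D Ob) F"
proof -
  interpret C: category C using F by (rule functor_dom)
  let ?S = "full_subcat_on D Ob"
  have F_Hom: "ArrMap F f \<in> Hom ?S (ObjMap F a) (ObjMap F b)" if f: "f \<in> Hom C a b" for a b f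
    using functor_Hom[OF F f] C.Hom_Obj[OF f] Ob by (simp add: Hom_full_subcat_on)
  show ?thesis
  proof (rule is_functorI)
    show "category C" "category ?S"
      using category_full_subcat_on[OF functor_cod[OF F] Ob(1)] C.category_axioms by auto
    show "ObjMap F \<in> Obj C \<rightarrow>\<^sub>E Obj ?S" "ArrMap F \<in> extensional (Arr C)"
      using functor_Obj_ext[OF F] functor_Arr_ext[OF F] Ob(2) by (auto simp: Obj_full_subcat_on)
    show "ArrMap F f \<in> Hom ?S (ObjMap F a) (ObjMap F b)" if "f \<in> Hom C a b" for a b f
      using F_Hom[OF that] .
    show "ArrMap F (Ident C a) = Ident ?S (ObjMap F a)" if "a \<in> Obj C" for a
      using that Ob(2) functor_Ident[OF F that] by (simp add: Ident_full_subcat_on)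
    show "ArrMap F (Comp C g f) = Comp ?S (ArrMap F g) (ArrMap F f)"
      if "f \<in> Hom C a b" "g \<in> Hom C b c" for a b c f g
      using functor_Comp[OF F that] Comp_full_subcat_on[OF F_Hom[OF that(1)] F_Hom[OF that(2)]]
      by simp
  qed
qed

lemma is_functor_inclusion:
  assumes "category D" "Ob \<subseteq> Obj D"
  shows "is_functor (full_subcat_on D Ob) D (id_func (full_subcat_on D Ob))"
proof (rule is_functorI)
  let ?S = "full_subcat_on D Ob"
  show S: "category ?S" by (rule category_full_subcat_on[OF assms])
  interpret S: category ?S by (rule S)
  show "category D" by fact
  show "ObjMap (id_func ?S) \<in> Obj ?S \<rightarrow>\<^sub>E Obj D" "ArrMap (id_func ?S) \<in> extensional (Arr ?S)"
    using assms(2) by (auto simp: id_func_def Obj_full_subcat_on)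
  show "ArrMap (id_func ?S) f \<in> Hom D (ObjMap (id_func ?S) a) (ObjMap (id_func ?S) b)"
    if f: "f \<in> Hom ?S a b" for a b f
    using f S.Hom_Obj[OF f] HomD(1)[OF f] by (simp add: func_apply Hom_full_subcat_on)
  show "ArrMap (id_func ?S) (Ident ?S a) = Ident D (ObjMap (id_func ?S) a)" if a: "a \<in> Obj ?S" for a
    using a HomD(1)[OF S.Ident_in[OF a]]
    by (simp add: func_apply Ident_full_subcat_on Obj_full_subcat_on)
  show "ArrMap (id_func ?S) (Comp ?S g f)
      = Comp D (ArrMap (id_func ?S) g) (ArrMap (id_func ?S) f)"
    if fg: "f \<in> Hom ?S a b" "g \<in> Hom ?S b c" for a b c f g
    using HomD(1)[OF fg(1)] HomD(1)[OF fg(2)] HomD(1)[OF S.Comp_in[OF fg]]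
    by (simp add: func_apply Comp_full_subcat_on[OF fg])
qed

context strict_coreflection
begin

abbreviation image_cat :: "('o2, 'a2) category" where
  "image_cat \<equiv> full_subcat_on D (ObjMap F ` Obj C)"

lemma image_Obj: "ObjMap F ` Obj C \<subseteq> Obj D"
  using functor_Obj[OF F] by auto

lemma FG_image_Obj: "b \<in> Obj image_cat \<Longrightarrow> ObjMap F (ObjMap G b) = b"
  by (auto simp: Obj_full_subcat_on GF_Obj)

lemma FG_image_Arr:
  assumes "g \<in> Arr image_cat"
  shows "ArrMap F (ArrMap G g) = g"
proof -
  obtain a a' where "a \<in> Obj C" "a' \<in> Obj C" "g \<in> Hom D (ObjMap F a) (ObjMap F a')"
    using assms by (force simp: Arr_full_subcat_on Hom_def)
  then show ?thesis by (rule FG_Arr)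
qed

text \<open>On the image of \<open>F\<close> the composite \<open>FG\<close> is the identity, and \<open>FG\<epsilon>\<close> consists of identities because
  \<open>G\<epsilon>\<close> does. Hence \<open>FG\<close> coreflects \<open>D\<close> onto the image, with the counit of the original pair.\<close>

lemma image_cat_strict_coreflection:
  "strict_coreflection image_cat D (id_func image_cat) (comp_func D F G) \<epsilon>"
proof
  let ?I = "id_func image_cat" and ?R = "comp_func D F G"
  show I: "is_functor image_cat D ?I"
    by (rule is_functor_inclusion[OF D.category_axioms image_Obj])
  show R: "is_functor D image_cat ?R"
    by (rule is_functor_into_full_subcat[OF is_functor_comp_func[OF G F] image_Obj])
      (simp add: func_apply functor_Obj[OF G])
  have Arr_D: "f \<in> Arr D" if "f \<in> Arr image_cat" for f
    using that by (simp add: Arr_full_subcat_on)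
  have Obj_D: "a \<in> Obj D" if "a \<in> Obj image_cat" for a
    using that image_Obj by (auto simp: Obj_full_subcat_on)
  show "comp_func image_cat ?R ?I = id_func image_cat"
    by (rule functor_eqI[where C = image_cat])
      (auto simp: func_apply FG_image_Obj FG_image_Arr Arr_D Obj_D, auto simp: comp_func_def id_func_def)
  have "comp_func D ?I ?R = ?R" by (rule comp_func_id_left[OF R])
  then show "nat_trans D D (comp_func D ?I ?R) (id_func D) \<epsilon>" using counit by simp
  show "\<epsilon> (ObjMap ?I a) = Ident D (ObjMap ?I a)" if "a \<in> Obj image_cat" for a
    using that counit_F by (auto simp: func_apply Obj_full_subcat_on)
  show "ArrMap ?R (\<epsilon> b) = Ident image_cat (ObjMap ?R b)" if b: "b \<in> Obj D" for b
    using functor_Obj[OF G b] HomD(1)[OF counit_Hom[OF b]]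
    by (simp add: func_apply b G_counit functor_Ident[OF F] Ident_full_subcat_on)
qed

lemma full_coreflective_image: "full_coreflective_subcategory image_cat D"
proof -
  interpret image: strict_coreflection image_cat D "id_func image_cat" "comp_func D F G" \<epsilon>
    by (rule image_cat_strict_coreflection)
  show ?thesis
    using image.right_adjoint_left_inverse
      full_subcategory_full_subcat_on[OF D.category_axioms image_Obj]
    unfolding full_coreflective_subcategory_def right_adjoint_left_inverse_def by blast
qed

text \<open>The inverse of \<open>F\<close> is the restriction of \<open>G\<close> to the image, written as the composite of \<open>G\<close> with
  the inclusion.\<close>

lemma isomorphic_image: "isomorphic_cat C image_cat"
proof -
  let ?G = "comp_func image_cat G (id_func image_cat)"
  have F': "is_functor C image_cat F"
    by (rule is_functor_into_full_subcat[OF F image_Obj]) auto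
  have G': "is_functor image_cat C ?G"
    by (rule is_functor_comp_func[OF is_functor_inclusion[OF D.category_axioms image_Obj] G])
  have "comp_func C ?G F = id_func C"
    by (rule functor_eqI[where C = C])
      (use functor_Obj[OF F'] functor_Arr[OF F']
        in \<open>auto simp: func_apply GF_Obj GF_Arr\<close>, auto simp: comp_func_def id_func_def)
  moreover have "comp_func image_cat F ?G = id_func image_cat"
    by (rule functor_eqI[where C = image_cat])
      (auto simp: func_apply FG_image_Obj FG_image_Arr, auto simp: comp_func_def id_func_def)
  ultimately show ?thesis unfolding isomorphic_cat_def using F' G' by blast
qed

end


section \<open>Lifting strict coreflections to institutions\<close>

lemma Obj_inst_cat: "(S, I) \<in> Obj (inst_cat D) \<longleftrightarrow> is_functor S D I"
  by (simp add: inst_cat_def Obj_triple_cat)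

lemma Hom_inst_cat:
  "u \<in> Hom (inst_cat D) (S1, I1) (S2, I2) \<longleftrightarrow>
    (\<exists>\<Phi> \<alpha>. u = ((S1, I1), (\<Phi>, \<alpha>), (S2, I2)) \<and> is_functor S1 S2 \<Phi> \<and> is_functor S2 D I2 \<and>
       nat_trans S1 D I1 (comp_func S1 I2 \<Phi>) \<alpha>)"
  by (auto simp: inst_cat_def Hom_triple_cat dest: nat_trans_dom)

lemma Ident_inst_cat:
  "is_functor S D I \<Longrightarrow> Ident (inst_cat D) (S, I) = ((S, I), (id_func S, id_nat S D I), (S, I))"
  by (simp add: inst_cat_def Ident_triple_cat)

lemma Comp_inst_cat:
  assumes "((S1, I1), (\<Phi>, \<alpha>), (S2, I2)) \<in> Hom (inst_cat D) (S1, I1) (S2, I2)"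
    and "((S2, I2), (\<Psi>, \<beta>), (S3, I3)) \<in> Hom (inst_cat D) (S2, I2) (S3, I3)"
  shows "Comp (inst_cat D) ((S2, I2), (\<Psi>, \<beta>), (S3, I3)) ((S1, I1), (\<Phi>, \<alpha>), (S2, I2)) =
    ((S1, I1), (comp_func S1 \<Psi> \<Phi>, comp_nat S1 D (whisker_right S1 \<beta> \<Phi>) \<alpha>), (S3, I3))"
  using Comp_triple_cat[OF assms[unfolded inst_cat_def]] by (simp add: inst_cat_def)

text \<open>In every law the signature parts are an instance of the corresponding law for functors, and
  the transformation parts agree at each signature \<open>s\<close> by the same law in \<open>D\<close>.\<close>

lemma category_inst_cat: "category (inst_cat D)"
  unfolding inst_cat_def
proof (rule category_triple_cat, goal_cases)
  case (1 a)
  then show ?case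
    by (auto simp: comp_func_id_right intro: nat_trans_id_nat is_functor_id_func functor_dom)
next
  case (2 a b c m n)
  obtain S1 I1 S2 I2 S3 I3 \<Phi> \<alpha> \<Psi> \<beta> where
    eqs: "a = (S1, I1)" "b = (S2, I2)" "c = (S3, I3)" "m = (\<Phi>, \<alpha>)" "n = (\<Psi>, \<beta>)"
    by (metis surj_pair)
  with 2 have \<Phi>: "is_functor S1 S2 \<Phi>" and \<Psi>: "is_functor S2 S3 \<Psi>"
    and \<alpha>: "nat_trans S1 D I1 (comp_func S1 I2 \<Phi>) \<alpha>"
    and \<beta>: "nat_trans S2 D I2 (comp_func S2 I3 \<Psi>) \<beta>" by auto
  show ?case
    using is_functor_comp_func[OF \<Phi> \<Psi>]
      nat_trans_comp_nat[OF \<alpha> nat_trans_whisker_right[OF \<beta> \<Phi>, unfolded comp_func_assoc[OF \<Phi>]]]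
    by (simp add: eqs)
next
  case (3 a b m)
  obtain S1 I1 S2 I2 \<Phi> \<alpha> where eqs: "a = (S1, I1)" "b = (S2, I2)" "m = (\<Phi>, \<alpha>)"
    by (metis surj_pair)
  with 3 have \<Phi>: "is_functor S1 S2 \<Phi>" and \<alpha>: "nat_trans S1 D I1 (comp_func S1 I2 \<Phi>) \<alpha>"
    and I2: "is_functor S2 D I2" by auto
  interpret D: category D using I2 by (rule functor_cod)
  have "comp_nat S1 D (whisker_right S1 (id_nat S2 D I2) \<Phi>) \<alpha> = \<alpha>"
  proof (rule extensionalityI[OF _ nat_trans_ext[OF \<alpha>]])
    fix s assume s: "s \<in> Obj S1"
    show "comp_nat S1 D (whisker_right S1 (id_nat S2 D I2) \<Phi>) \<alpha> s = \<alpha> s"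
      using s functor_Obj[OF \<Phi> s] D.Comp_Ident_left[OF nat_trans_Hom[OF \<alpha> s]]
      by (simp add: comp_nat_def whisker_right_def id_nat_def func_apply)
  qed (simp add: comp_nat_def)
  then show ?case using comp_func_id_left[OF \<Phi>] by (simp add: eqs)
next
  case (4 a b m)
  obtain S1 I1 S2 I2 \<Phi> \<alpha> where eqs: "a = (S1, I1)" "b = (S2, I2)" "m = (\<Phi>, \<alpha>)"
    by (metis surj_pair)
  with 4 have \<Phi>: "is_functor S1 S2 \<Phi>" and \<alpha>: "nat_trans S1 D I1 (comp_func S1 I2 \<Phi>) \<alpha>"
    and I2: "is_functor S2 D I2" by auto
  interpret D: category D using I2 by (rule functor_cod)
  have "comp_nat S1 D (whisker_right S1 \<alpha> (id_func S1)) (id_nat S1 D I1) = \<alpha>"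
  proof (rule extensionalityI[OF _ nat_trans_ext[OF \<alpha>]])
    fix s assume s: "s \<in> Obj S1"
    show "comp_nat S1 D (whisker_right S1 \<alpha> (id_func S1)) (id_nat S1 D I1) s = \<alpha> s"
      using s D.Comp_Ident_right[OF nat_trans_Hom[OF \<alpha> s]]
      by (simp add: comp_nat_def whisker_right_def id_nat_def func_apply)
  qed (simp add: comp_nat_def)
  then show ?case using comp_func_id_right[OF \<Phi>] by (simp add: eqs)
next
  case (5 a b c d m n p)
  obtain S1 I1 S2 I2 S3 I3 S4 I4 \<Phi> \<alpha> \<Psi> \<beta> X \<gamma> where
    eqs: "a = (S1, I1)" "b = (S2, I2)" "c = (S3, I3)" "d = (S4, I4)" "m = (\<Phi>, \<alpha>)" "n = (\<Psi>, \<beta>)"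
      "p = (X, \<gamma>)"
    by (metis surj_pair)
  with 5 have \<Phi>: "is_functor S1 S2 \<Phi>" and \<Psi>: "is_functor S2 S3 \<Psi>"
    and \<alpha>: "nat_trans S1 D I1 (comp_func S1 I2 \<Phi>) \<alpha>"
    and \<beta>: "nat_trans S2 D I2 (comp_func S2 I3 \<Psi>) \<beta>"
    and \<gamma>: "nat_trans S3 D I3 (comp_func S3 I4 X) \<gamma>" by auto
  interpret D: category D using functor_cod[OF nat_trans_dom[OF \<alpha>]] .
  have "comp_nat S1 D (whisker_right S1 \<gamma> (comp_func S1 \<Psi> \<Phi>)) (comp_nat S1 D (whisker_right S1 \<beta> \<Phi>) \<alpha>)
      = comp_nat S1 D (whisker_right S1 (comp_nat S2 D (whisker_right S2 \<gamma> \<Psi>) \<beta>) \<Phi>) \<alpha>"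
  proof (rule extensionalityI[where A = "Obj S1"])
    fix s assume s: "s \<in> Obj S1"
    note s2 = functor_Obj[OF \<Phi> s]
    note s3 = functor_Obj[OF \<Psi> s2]
    show "comp_nat S1 D (whisker_right S1 \<gamma> (comp_func S1 \<Psi> \<Phi>))
        (comp_nat S1 D (whisker_right S1 \<beta> \<Phi>) \<alpha>) s
      = comp_nat S1 D (whisker_right S1 (comp_nat S2 D (whisker_right S2 \<gamma> \<Psi>) \<beta>) \<Phi>) \<alpha> s"
      using s s2 s3 nat_trans_Hom[OF \<alpha> s] nat_trans_Hom[OF \<beta> s2] nat_trans_Hom[OF \<gamma> s3]
      by (simp add: comp_nat_def whisker_right_def func_apply D.Comp_assoc)
  qed (simp_all add: comp_nat_def)
  then show ?case using comp_func_assoc[OF \<Phi>, of X \<Psi>] by (simp add: eqs)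
qed

text \<open>The functor between categories of institutions given by composition with \<open>K\<close>; both \<open>IE\<close> and
  \<open>ISpat\<close> have this form.\<close>

definition inst_func :: "('o1, 'a1) category \<Rightarrow> ('o1, 'a1, 'o2, 'a2) func \<Rightarrow>
    (('s, 't, 'o1, 'a1) inst, ('s, 't, 'o1, 'a1) inst_arr,
     ('s, 't, 'o2, 'a2) inst, ('s, 't, 'o2, 'a2) inst_arr) func" where
  "inst_func C K =
     \<lparr>ObjMap = restrict (\<lambda>(S, I). (S, comp_func S K I)) (Obj (inst_cat C)),
      ArrMap = restrict
        (\<lambda>((S1, I1), (\<Phi>, \<alpha>), (S2, I2)).
           ((S1, comp_func S1 K I1), (\<Phi>, whisker_left S1 K \<alpha>), (S2, comp_func S2 K I2)))
        (Arr (inst_cat C))\<rparr>"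

lemma ObjMap_inst_func:
  "is_functor S C I \<Longrightarrow> ObjMap (inst_func C K) (S, I) = (S, comp_func S K I)"
  by (simp add: inst_func_def Obj_inst_cat)

lemma ArrMap_inst_func:
  assumes "((S1, I1), (\<Phi>, \<alpha>), (S2, I2)) \<in> Hom (inst_cat C) (S1, I1) (S2, I2)"
  shows "ArrMap (inst_func C K) ((S1, I1), (\<Phi>, \<alpha>), (S2, I2)) =
    ((S1, comp_func S1 K I1), (\<Phi>, whisker_left S1 K \<alpha>), (S2, comp_func S2 K I2))"
  using HomD(1)[OF assms] by (simp add: inst_func_def)

lemma inst_func_Hom:
  assumes K: "is_functor C D K" and \<Phi>: "is_functor S1 S2 \<Phi>" and I2: "is_functor S2 C I2"
    and \<alpha>: "nat_trans S1 C I1 (comp_func S1 I2 \<Phi>) \<alpha>"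
  shows "((S1, comp_func S1 K I1), (\<Phi>, whisker_left S1 K \<alpha>), (S2, comp_func S2 K I2))
    \<in> Hom (inst_cat D) (S1, comp_func S1 K I1) (S2, comp_func S2 K I2)"
  using \<Phi> is_functor_comp_func[OF I2 K] nat_trans_whisker_left[OF \<alpha> K]
  by (simp add: Hom_inst_cat comp_func_assoc[OF \<Phi>])

lemma is_functor_inst_func:
  assumes K: "is_functor C D K"
  shows "is_functor (inst_cat C) (inst_cat D) (inst_func C K)"
proof (rule is_functorI)
  interpret IC: category "inst_cat C" by (rule category_inst_cat)
  show "category (inst_cat C)" "category (inst_cat D)" by (rule category_inst_cat)+
  show "ObjMap (inst_func C K) \<in> Obj (inst_cat C) \<rightarrow>\<^sub>E Obj (inst_cat D)"
    using K by (auto simp: inst_func_def Obj_inst_cat intro: is_functor_comp_func)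
  show "ArrMap (inst_func C K) \<in> extensional (Arr (inst_cat C))" by (simp add: inst_func_def)
  show "ArrMap (inst_func C K) u
      \<in> Hom (inst_cat D) (ObjMap (inst_func C K) a) (ObjMap (inst_func C K) b)"
    if u: "u \<in> Hom (inst_cat C) a b" for a b u
  proof -
    obtain S1 I1 S2 I2 where ab: "a = (S1, I1)" "b = (S2, I2)" by (metis surj_pair)
    obtain \<Phi> \<alpha> where u_eq: "u = ((S1, I1), (\<Phi>, \<alpha>), (S2, I2))" and \<Phi>: "is_functor S1 S2 \<Phi>"
      and I2: "is_functor S2 C I2" and \<alpha>: "nat_trans S1 C I1 (comp_func S1 I2 \<Phi>) \<alpha>"
      using u unfolding ab Hom_inst_cat by blast
    show ?thesis
      using inst_func_Hom[OF K \<Phi> I2 \<alpha>] u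
      by (simp add: u_eq ab ArrMap_inst_func ObjMap_inst_func I2 nat_trans_dom[OF \<alpha>])
  qed
  show "ArrMap (inst_func C K) (Ident (inst_cat C) a) = Ident (inst_cat D) (ObjMap (inst_func C K) a)"
    if a: "a \<in> Obj (inst_cat C)" for a
  proof -
    obtain S I where a_eq: "a = (S, I)" by (cases a)
    have I: "is_functor S C I" using a by (simp add: a_eq Obj_inst_cat)
    have "whisker_left S K (id_nat S C I) = id_nat S D (comp_func S K I)"
      by (auto simp: whisker_left_def id_nat_def fun_eq_iff func_apply
          functor_Ident[OF K functor_Obj[OF I]])
    then show ?thesis
      using IC.Ident_in[OF a] is_functor_comp_func[OF I K]
      by (simp add: a_eq Ident_inst_cat I ArrMap_inst_func ObjMap_inst_func)
  qed
  show "ArrMap (inst_func C K) (Comp (inst_cat C) v u)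
      = Comp (inst_cat D) (ArrMap (inst_func C K) v) (ArrMap (inst_func C K) u)"
    if u: "u \<in> Hom (inst_cat C) a b" and v: "v \<in> Hom (inst_cat C) b c" for a b c u v
  proof -
    obtain S1 I1 S2 I2 S3 I3 where abc: "a = (S1, I1)" "b = (S2, I2)" "c = (S3, I3)"
      by (metis surj_pair)
    obtain \<Phi> \<alpha> where u_eq: "u = ((S1, I1), (\<Phi>, \<alpha>), (S2, I2))" and \<Phi>: "is_functor S1 S2 \<Phi>"
      and I2: "is_functor S2 C I2" and \<alpha>: "nat_trans S1 C I1 (comp_func S1 I2 \<Phi>) \<alpha>"
      using u unfolding abc Hom_inst_cat by blast
    obtain \<Psi> \<beta> where v_eq: "v = ((S2, I2), (\<Psi>, \<beta>), (S3, I3))" and \<Psi>: "is_functor S2 S3 \<Psi>"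
      and I3: "is_functor S3 C I3" and \<beta>: "nat_trans S2 C I2 (comp_func S2 I3 \<Psi>) \<beta>"
      using v unfolding abc Hom_inst_cat by blast
    have "whisker_left S1 K (comp_nat S1 C (whisker_right S1 \<beta> \<Phi>) \<alpha>)
      = comp_nat S1 D (whisker_right S1 (whisker_left S2 K \<beta>) \<Phi>) (whisker_left S1 K \<alpha>)"
    proof (rule extensionalityI[where A = "Obj S1"])
      fix s assume s: "s \<in> Obj S1"
      note s2 = functor_Obj[OF \<Phi> s]
      show "whisker_left S1 K (comp_nat S1 C (whisker_right S1 \<beta> \<Phi>) \<alpha>) s
        = comp_nat S1 D (whisker_right S1 (whisker_left S2 K \<beta>) \<Phi>) (whisker_left S1 K \<alpha>) s"
        using s s2 nat_trans_Hom[OF \<alpha> s] nat_trans_Hom[OF \<beta> s2]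
        by (simp add: whisker_left_def comp_nat_def whisker_right_def func_apply functor_Comp[OF K])
    qed (simp_all add: whisker_left_def comp_nat_def)
    then show ?thesis
      using u v IC.Comp_in[OF u v] inst_func_Hom[OF K \<Phi> I2 \<alpha>] inst_func_Hom[OF K \<Psi> I3 \<beta>]
      by (simp add: abc u_eq v_eq Comp_inst_cat ArrMap_inst_func)
  qed
qed

lemma inst_func_id:
  assumes "category C"
  shows "inst_func C (id_func C) = id_func (inst_cat C)"
proof (rule functor_eqI[where C = "inst_cat C"])
  fix a assume "a \<in> Obj (inst_cat C)"
  then show "ObjMap (inst_func C (id_func C)) a = ObjMap (id_func (inst_cat C)) a"
    by (cases a) (simp add: Obj_inst_cat ObjMap_inst_func ObjMap_id_func comp_func_id_left)
next
  fix u assume u: "u \<in> Arr (inst_cat C)"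
  obtain S1 I1 S2 I2 \<Phi> \<alpha> where u_eq: "u = ((S1, I1), (\<Phi>, \<alpha>), (S2, I2))" by (metis surj_pair)
  have uH: "u \<in> Hom (inst_cat C) (S1, I1) (S2, I2)"
    using u by (auto simp: u_eq inst_cat_def triple_cat_def Let_def Hom_def)
  then have I2: "is_functor S2 C I2" and \<alpha>: "nat_trans S1 C I1 (comp_func S1 I2 \<Phi>) \<alpha>"
    by (auto simp: Hom_inst_cat u_eq)
  have "whisker_left S1 (id_func C) \<alpha> = \<alpha>"
    by (rule extensionalityI[OF _ nat_trans_ext[OF \<alpha>]])
      (simp_all add: whisker_left_def func_apply HomD(1)[OF nat_trans_Hom[OF \<alpha>]])
  then show "ArrMap (inst_func C (id_func C)) u = ArrMap (id_func (inst_cat C)) u"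
    using uH u by (simp add: u_eq ArrMap_inst_func ArrMap_id_func comp_func_id_left[OF I2]
        comp_func_id_left[OF nat_trans_dom[OF \<alpha>]])
qed (auto simp: inst_func_def id_func_def)

text \<open>Together with \<open>inst_func_id\<close>, this transports the equation \<open>GF = 1\<close> to institutions, and it
  identifies the domain of the counit with composition with \<open>FG\<close>.\<close>

lemma inst_func_comp:
  assumes K: "is_functor C D K"
  shows "comp_func (inst_cat C) (inst_func D L) (inst_func C K) = inst_func C (comp_func C L K)"
proof (rule functor_eqI[where C = "inst_cat C"])
  fix a assume "a \<in> Obj (inst_cat C)"
  then show "ObjMap (comp_func (inst_cat C) (inst_func D L) (inst_func C K)) a
      = ObjMap (inst_func C (comp_func C L K)) a"
    by (cases a) (simp add: Obj_inst_cat ObjMap_inst_func ObjMap_comp_func comp_func_assoc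
        is_functor_comp_func[OF _ K])
next
  fix u assume u: "u \<in> Arr (inst_cat C)"
  obtain S1 I1 S2 I2 \<Phi> \<alpha> where u_eq: "u = ((S1, I1), (\<Phi>, \<alpha>), (S2, I2))" by (metis surj_pair)
  have uH: "u \<in> Hom (inst_cat C) (S1, I1) (S2, I2)"
    using u by (auto simp: u_eq inst_cat_def triple_cat_def Let_def Hom_def)
  then have \<Phi>: "is_functor S1 S2 \<Phi>" and I2: "is_functor S2 C I2"
    and \<alpha>: "nat_trans S1 C I1 (comp_func S1 I2 \<Phi>) \<alpha>"
    by (auto simp: Hom_inst_cat u_eq)
  have "whisker_left S1 L (whisker_left S1 K \<alpha>) = whisker_left S1 (comp_func C L K) \<alpha>"
    by (auto simp: whisker_left_def fun_eq_iff func_apply HomD(1)[OF nat_trans_Hom[OF \<alpha>]])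
  then show "ArrMap (comp_func (inst_cat C) (inst_func D L) (inst_func C K)) u
      = ArrMap (inst_func C (comp_func C L K)) u"
    using uH u inst_func_Hom[OF K \<Phi> I2 \<alpha>]
    by (simp add: u_eq ArrMap_inst_func ArrMap_comp_func comp_func_assoc[OF I2]
        comp_func_assoc[OF nat_trans_dom[OF \<alpha>]])
qed (auto simp: inst_func_def comp_func_def)

context strict_coreflection
begin

definition inst_counit :: "('s, 't, 'o2, 'a2) inst \<Rightarrow> ('s, 't, 'o2, 'a2) inst_arr" where
  "inst_counit = restrict
     (\<lambda>(S, I). ((S, comp_func S (comp_func D F G) I), (id_func S, whisker_right S \<epsilon> I), (S, I)))
     (Obj (inst_cat D))"

lemma inst_counit_apply:
  "is_functor S D I \<Longrightarrow> inst_counit (S, I) =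
    ((S, comp_func S (comp_func D F G) I), (id_func S, whisker_right S \<epsilon> I), (S, I))"
  by (simp add: inst_counit_def Obj_inst_cat)

lemma inst_counit_Hom:
  assumes I: "is_functor S D I"
  shows "((S, comp_func S (comp_func D F G) I), (id_func S, whisker_right S \<epsilon> I), (S, I))
    \<in> Hom (inst_cat D) (S, comp_func S (comp_func D F G) I) (S, I)"
  using nat_trans_whisker_right[OF counit I] is_functor_id_func[OF functor_dom[OF I]] I
  by (simp add: Hom_inst_cat comp_func_id_left[OF I] comp_func_id_right[OF I])

text \<open>Naturality of the lifted counit at \<open>(\<Phi>, \<alpha>)\<close> reduces at a signature \<open>s\<close> to naturality of \<open>\<epsilon>\<close> at
  the arrow \<open>\<alpha> s\<close>.\<close>

lemma inst_strict_coreflection: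
  "strict_coreflection (inst_cat C) (inst_cat D) (inst_func C F) (inst_func D G)
     (inst_counit :: ('s, 't, 'o2, 'a2) inst \<Rightarrow> _)"
proof
  let ?F = "inst_func C F" and ?G = "inst_func D G"
  let ?\<epsilon> = "inst_counit :: ('s, 't, 'o2, 'a2) inst \<Rightarrow> _"
  note FG = is_functor_comp_func[OF G F]
  show IF: "is_functor (inst_cat C) (inst_cat D) ?F" by (rule is_functor_inst_func[OF F])
  show IG: "is_functor (inst_cat D) (inst_cat C) ?G" by (rule is_functor_inst_func[OF G])
  show "comp_func (inst_cat C) ?G ?F = id_func (inst_cat C)"
    by (simp add: inst_func_comp[OF F] left_inverse inst_func_id[OF C.category_axioms])
  show "nat_trans (inst_cat D) (inst_cat D) (comp_func (inst_cat D) ?F ?G) (id_func (inst_cat D)) ?\<epsilon>"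
    unfolding inst_func_comp[OF G]
  proof (rule nat_transI)
    show "is_functor (inst_cat D) (inst_cat D) (inst_func D (comp_func D F G))"
      by (rule is_functor_inst_func[OF FG])
    show "is_functor (inst_cat D) (inst_cat D) (id_func (inst_cat D))"
      by (rule is_functor_id_func[OF category_inst_cat])
    show "?\<epsilon> \<in> extensional (Obj (inst_cat D))" by (simp add: inst_counit_def)
    show "?\<epsilon> a \<in> Hom (inst_cat D) (ObjMap (inst_func D (comp_func D F G)) a)
        (ObjMap (id_func (inst_cat D)) a)" if "a \<in> Obj (inst_cat D)" for a
      using that inst_counit_Hom
      by (cases a) (simp add: ObjMap_id_func Obj_inst_cat ObjMap_inst_func inst_counit_apply)
    show "Comp (inst_cat D) (?\<epsilon> b) (ArrMap (inst_func D (comp_func D F G)) u)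
        = Comp (inst_cat D) (ArrMap (id_func (inst_cat D)) u) (?\<epsilon> a)"
      if u: "u \<in> Hom (inst_cat D) a b" for a b u
    proof -
      obtain S1 I1 S2 I2 where ab: "a = (S1, I1)" "b = (S2, I2)" by (metis surj_pair)
      obtain \<Phi> \<alpha> where u_eq: "u = ((S1, I1), (\<Phi>, \<alpha>), (S2, I2))" and \<Phi>: "is_functor S1 S2 \<Phi>"
        and I2: "is_functor S2 D I2" and \<alpha>: "nat_trans S1 D I1 (comp_func S1 I2 \<Phi>) \<alpha>"
        using u unfolding ab Hom_inst_cat by blast
      note I1 = nat_trans_dom[OF \<alpha>]
      have "comp_nat S1 D (whisker_right S1 (whisker_right S2 \<epsilon> I2) \<Phi>)
          (whisker_left S1 (comp_func D F G) \<alpha>)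
        = comp_nat S1 D (whisker_right S1 \<alpha> (id_func S1)) (whisker_right S1 \<epsilon> I1)"
      proof (rule extensionalityI[where A = "Obj S1"])
        fix s assume s: "s \<in> Obj S1"
        have "\<alpha> s \<in> Hom D (ObjMap I1 s) (ObjMap I2 (ObjMap \<Phi> s))"
          using nat_trans_Hom[OF \<alpha> s] s by (simp add: func_apply)
        from counit_natural[OF this] HomD(1)[OF this] s functor_Obj[OF \<Phi> s]
        show "comp_nat S1 D (whisker_right S1 (whisker_right S2 \<epsilon> I2) \<Phi>)
            (whisker_left S1 (comp_func D F G) \<alpha>) s
          = comp_nat S1 D (whisker_right S1 \<alpha> (id_func S1)) (whisker_right S1 \<epsilon> I1) s"
          by (simp add: comp_nat_def whisker_right_def whisker_left_def func_apply)
      qed (simp_all add: comp_nat_def)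
      then show ?thesis
        using u HomD(1)[OF u] inst_func_Hom[OF FG \<Phi> I2 \<alpha>] inst_counit_Hom[OF I1]
          inst_counit_Hom[OF I2]
        by (simp add: ab u_eq ArrMap_id_func ArrMap_inst_func inst_counit_apply I1 I2 Comp_inst_cat
            comp_func_id_left[OF \<Phi>] comp_func_id_right[OF \<Phi>])
    qed
  qed
  show "?\<epsilon> (ObjMap ?F a) = Ident (inst_cat D) (ObjMap ?F a)" if a: "a \<in> Obj (inst_cat C)" for a
  proof -
    obtain S I where a_eq: "a = (S, I)" by (cases a)
    have I: "is_functor S C I" using a by (simp add: a_eq Obj_inst_cat)
    have "comp_func S (comp_func D F G) (comp_func S F I) = comp_func S F (comp_func S (comp_func C G F) I)"
      using I F by (simp add: comp_func_assoc[OF is_functor_comp_func[OF I F]] comp_func_assoc[OF I])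
    then have *: "comp_func S (comp_func D F G) (comp_func S F I) = comp_func S F I"
      by (simp add: left_inverse comp_func_id_left[OF I])
    have "whisker_right S \<epsilon> (comp_func S F I) = id_nat S D (comp_func S F I)"
      by (auto simp: whisker_right_def id_nat_def fun_eq_iff func_apply
          counit_F[OF functor_Obj[OF I]])
    with * show ?thesis
      by (simp add: a_eq ObjMap_inst_func I inst_counit_apply Ident_inst_cat
          is_functor_comp_func[OF I F])
  qed
  show "ArrMap ?G (?\<epsilon> b) = Ident (inst_cat C) (ObjMap ?G b)" if b: "b \<in> Obj (inst_cat D)" for b
  proof -
    obtain S I where b_eq: "b = (S, I)" by (cases b)
    have I: "is_functor S D I" using b by (simp add: b_eq Obj_inst_cat)
    note GI = is_functor_comp_func[OF I G]
    have "comp_func S G (comp_func S (comp_func D F G) I)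
        = comp_func S (comp_func C G F) (comp_func S G I)"
      by (simp add: comp_func_assoc[OF GI] comp_func_assoc[OF I])
    then have *: "comp_func S G (comp_func S (comp_func D F G) I) = comp_func S G I"
      by (simp add: left_inverse comp_func_id_left[OF GI])
    have "whisker_left S G (whisker_right S \<epsilon> I) = id_nat S C (comp_func S G I)"
      by (auto simp: whisker_left_def whisker_right_def id_nat_def fun_eq_iff func_apply
          G_counit[OF functor_Obj[OF I]])
    with * show ?thesis
      by (simp add: b_eq ObjMap_inst_func I inst_counit_apply Ident_inst_cat GI
          ArrMap_inst_func[OF inst_counit_Hom])
  qed
qed

end


section \<open>Algebras\<close>

lemma alg_homD:
  assumes "\<phi> \<in> alg_hom \<Omega> A B"
  shows alg_hom_ext: "\<phi> \<in> extensional (Carrier A)"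
    and alg_hom_in: "a \<in> Carrier A \<Longrightarrow> \<phi> a \<in> Carrier B"
    and alg_hom_Op: "\<lbrakk>l \<in> Ops \<Omega>; x \<in> Arity \<Omega> l \<rightarrow>\<^sub>E Carrier A\<rbrakk> \<Longrightarrow>
      \<phi> (Op A l x) = Op B l (compose (Arity \<Omega> l) \<phi> x)"
  using assms by (auto simp: alg_hom_def PiE_def)

lemma alg_homI:
  assumes "\<phi> \<in> extensional (Carrier A)" "\<And>a. a \<in> Carrier A \<Longrightarrow> \<phi> a \<in> Carrier B"
    and "\<And>l x. \<lbrakk>l \<in> Ops \<Omega>; x \<in> Arity \<Omega> l \<rightarrow>\<^sub>E Carrier A\<rbrakk> \<Longrightarrow>
      \<phi> (Op A l x) = Op B l (compose (Arity \<Omega> l) \<phi> x)"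
  shows "\<phi> \<in> alg_hom \<Omega> A B"
  using assms by (auto simp: alg_hom_def PiE_def)

lemma algebra_Op_in:
  assumes "is_algebra \<Omega> A" "l \<in> Ops \<Omega>" "x \<in> Arity \<Omega> l \<rightarrow>\<^sub>E Carrier A"
  shows "Op A l x \<in> Carrier A"
  by (rule PiE_mem[OF PiE_mem[OF assms(1)[unfolded is_algebra_def] assms(2)] assms(3)])

lemma compose_in_PiE:
  assumes "x \<in> I \<rightarrow>\<^sub>E A" "\<And>a. a \<in> A \<Longrightarrow> \<phi> a \<in> B"
  shows "compose I \<phi> x \<in> I \<rightarrow>\<^sub>E B"
  using assms by (auto simp: compose_def)

lemma alg_hom_compose:
  assumes A: "is_algebra \<Omega> A" and \<phi>: "\<phi> \<in> alg_hom \<Omega> A B" and \<psi>: "\<psi> \<in> alg_hom \<Omega> B C"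
  shows "compose (Carrier A) \<psi> \<phi> \<in> alg_hom \<Omega> A C"
proof (rule alg_homI)
  fix l x assume l: "l \<in> Ops \<Omega>" and x: "x \<in> Arity \<Omega> l \<rightarrow>\<^sub>E Carrier A"
  have "compose (Arity \<Omega> l) \<psi> (compose (Arity \<Omega> l) \<phi> x)
      = compose (Arity \<Omega> l) (compose (Carrier A) \<psi> \<phi>) x"
    using x by (auto simp: compose_def fun_eq_iff)
  then show "compose (Carrier A) \<psi> \<phi> (Op A l x)
      = Op C l (compose (Arity \<Omega> l) (compose (Carrier A) \<psi> \<phi>) x)"
    using algebra_Op_in[OF A l x] alg_hom_Op[OF \<phi> l x]
      alg_hom_Op[OF \<psi> l compose_in_PiE[OF x alg_hom_in[OF \<phi>]]]
    by (simp add: compose_eq)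
qed (use alg_hom_in[OF \<phi>] alg_hom_in[OF \<psi>] in \<open>auto simp: compose_eq\<close>)

lemma subalgebraD:
  assumes "subalgebra \<Omega> S A"
  shows "is_algebra \<Omega> S" "is_algebra \<Omega> A" "Carrier S \<subseteq> Carrier A"
    and "\<lbrakk>l \<in> Ops \<Omega>; x \<in> Arity \<Omega> l \<rightarrow>\<^sub>E Carrier S\<rbrakk> \<Longrightarrow> Op S l x = Op A l x"
  using assms by (auto simp: subalgebra_def)

lemma subalgebra_refl: "is_algebra \<Omega> A \<Longrightarrow> subalgebra \<Omega> A A"
  by (simp add: subalgebra_def)

lemma alg_hom_id:
  assumes A: "is_algebra \<Omega> A"
  shows "(\<lambda>a\<in>Carrier A. a) \<in> alg_hom \<Omega> A A"
proof (rule alg_homI)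
  fix l x assume l: "l \<in> Ops \<Omega>" and x: "x \<in> Arity \<Omega> l \<rightarrow>\<^sub>E Carrier A"
  have "compose (Arity \<Omega> l) (\<lambda>a\<in>Carrier A. a) x = x"
    by (rule extensionalityI[where A = "Arity \<Omega> l"]) (use x in \<open>auto simp: compose_def PiE_def\<close>)
  then show "(\<lambda>a\<in>Carrier A. a) (Op A l x)
      = Op A l (compose (Arity \<Omega> l) (\<lambda>a\<in>Carrier A. a) x)"
    using algebra_Op_in[OF A l x] by simp
qed auto

text \<open>Inclusions of subalgebras, corestrictions to a subalgebra and the homomorphism part of \<open>E f\<close>
  are all obtained from this one construction.\<close>

lemma alg_hom_restrict:
  assumes \<phi>: "\<phi> \<in> alg_hom \<Omega> A B" and S: "subalgebra \<Omega> S A" and R: "subalgebra \<Omega> R B"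
    and im: "\<And>a. a \<in> Carrier S \<Longrightarrow> \<phi> a \<in> Carrier R"
  shows "restrict \<phi> (Carrier S) \<in> alg_hom \<Omega> S R"
proof (rule alg_homI)
  fix l x assume l: "l \<in> Ops \<Omega>" and x: "x \<in> Arity \<Omega> l \<rightarrow>\<^sub>E Carrier S"
  have xA: "x \<in> Arity \<Omega> l \<rightarrow>\<^sub>E Carrier A" using x subalgebraD(3)[OF S] by auto
  have "compose (Arity \<Omega> l) (restrict \<phi> (Carrier S)) x = compose (Arity \<Omega> l) \<phi> x"
    using x by (auto simp: compose_def fun_eq_iff)
  then show "restrict \<phi> (Carrier S) (Op S l x)
      = Op R l (compose (Arity \<Omega> l) (restrict \<phi> (Carrier S)) x)"
    using algebra_Op_in[OF subalgebraD(1)[OF S] l x] subalgebraD(4)[OF S l x] alg_hom_Op[OF \<phi> l xA]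
      subalgebraD(4)[OF R l compose_in_PiE[OF x im]]
    by simp
qed (use im in auto)

lemma alg_hom_corestrict:
  assumes \<phi>: "\<phi> \<in> alg_hom \<Omega> A B" and A: "is_algebra \<Omega> A" and R: "subalgebra \<Omega> R B"
    and im: "\<And>a. a \<in> Carrier A \<Longrightarrow> \<phi> a \<in> Carrier R"
  shows "\<phi> \<in> alg_hom \<Omega> A R"
  using alg_hom_restrict[OF \<phi> subalgebra_refl[OF A] R im] alg_hom_ext[OF \<phi>]
  by (simp add: extensional_restrict)

lemma alg_hom_inclusion:
  assumes S: "subalgebra \<Omega> S A"
  shows "(\<lambda>a\<in>Carrier S. a) \<in> alg_hom \<Omega> S A"
proof -
  note A = subalgebraD(2)[OF S]
  have "restrict (\<lambda>a\<in>Carrier A. a) (Carrier S) = (\<lambda>a\<in>Carrier S. a)"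
    using subalgebraD(3)[OF S] by (auto simp: restrict_def fun_eq_iff)
  moreover have "restrict (\<lambda>a\<in>Carrier A. a) (Carrier S) \<in> alg_hom \<Omega> S A"
    by (rule alg_hom_restrict[OF alg_hom_id[OF A] S subalgebra_refl[OF A]])
      (use subalgebraD(3)[OF S] in auto)
  ultimately show ?thesis by (simp only:)
qed

text \<open>Arities may be infinite, so preimages of all arguments of an operation are picked by choice.\<close>

lemma subalgebra_image:
  assumes A: "is_algebra \<Omega> A" and B: "is_algebra \<Omega> B" and \<phi>: "\<phi> \<in> alg_hom \<Omega> A B"
  shows "subalgebra \<Omega> (restrict_alg \<Omega> B (\<phi> ` Carrier A)) B"
proof -
  let ?R = "\<phi> ` Carrier A"
  have closed: "Op B l y \<in> ?R" if l: "l \<in> Ops \<Omega>" and y: "y \<in> Arity \<Omega> l \<rightarrow>\<^sub>E ?R" for l y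
  proof -
    define x where "x = (\<lambda>i\<in>Arity \<Omega> l. SOME a. a \<in> Carrier A \<and> \<phi> a = y i)"
    have x: "x i \<in> Carrier A \<and> \<phi> (x i) = y i" if i: "i \<in> Arity \<Omega> l" for i
    proof -
      have "\<exists>a. a \<in> Carrier A \<and> \<phi> a = y i" using PiE_mem[OF y i] by auto
      from someI_ex[OF this] show ?thesis using i by (simp add: x_def)
    qed
    have xA: "x \<in> Arity \<Omega> l \<rightarrow>\<^sub>E Carrier A" using x by (auto simp: x_def)
    have "compose (Arity \<Omega> l) \<phi> x = y"
      by (rule extensionalityI[where A = "Arity \<Omega> l"]) (use x y in \<open>auto simp: compose_eq PiE_def\<close>)
    then have "Op B l y = \<phi> (Op A l x)" using alg_hom_Op[OF \<phi> l xA] by simp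
    then show ?thesis using algebra_Op_in[OF A l xA] by blast
  qed
  then show ?thesis
    using B alg_hom_in[OF \<phi>] by (auto simp: subalgebra_def is_algebra_def restrict_alg_def)
qed

text \<open>This is an equation of algebras, not merely of their carriers, because operations are
  extensional. It is the reason for \<open>Spat E = 1\<close> on the nose.\<close>

lemma restrict_alg_subalgebra:
  assumes S: "subalgebra \<Omega> S A"
  shows "restrict_alg \<Omega> A (Carrier S) = S"
proof -
  note Op_S = subalgebraD(1)[OF S, unfolded is_algebra_def]
  have "(\<lambda>l\<in>Ops \<Omega>. \<lambda>x\<in>Arity \<Omega> l \<rightarrow>\<^sub>E Carrier S. Op A l x) = Op S"
  proof (rule extensionalityI[where A = "Ops \<Omega>"])
    fix l assume l: "l \<in> Ops \<Omega>"
    have "(\<lambda>x\<in>Arity \<Omega> l \<rightarrow>\<^sub>E Carrier S. Op A l x) = Op S l"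
      by (rule extensionalityI[where A = "Arity \<Omega> l \<rightarrow>\<^sub>E Carrier S"])
        (use PiE_mem[OF Op_S l] subalgebraD(4)[OF S l] in \<open>auto simp: PiE_def\<close>)
    with l show "(\<lambda>l\<in>Ops \<Omega>. \<lambda>x\<in>Arity \<Omega> l \<rightarrow>\<^sub>E Carrier S. Op A l x) l = Op S l" by simp
  qed (use Op_S in \<open>auto simp: PiE_def\<close>)
  then show ?thesis by (simp add: restrict_alg_def)
qed

lemma Carrier_restrict_alg: "Carrier (restrict_alg \<Omega> A R) = R"
  by (simp add: restrict_alg_def)

lemma Obj_alg_cat: "Obj (alg_cat \<Omega> V) = V"
  by (simp add: alg_cat_def Obj_triple_cat)

lemma Hom_alg_cat:
  "u \<in> Hom (alg_cat \<Omega> V) A B \<longleftrightarrow> (\<exists>\<phi>\<in>alg_hom \<Omega> A B. u = (A, \<phi>, B) \<and> A \<in> V \<and> B \<in> V)"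
  by (simp add: alg_cat_def Hom_triple_cat)

lemma Ident_alg_cat: "A \<in> V \<Longrightarrow> Ident (alg_cat \<Omega> V) A = (A, \<lambda>a\<in>Carrier A. a, A)"
  by (simp add: alg_cat_def Ident_triple_cat)

lemma Comp_alg_cat:
  assumes "\<phi> \<in> alg_hom \<Omega> A B" "\<psi> \<in> alg_hom \<Omega> B C" "A \<in> V" "B \<in> V" "C \<in> V"
  shows "Comp (alg_cat \<Omega> V) (B, \<psi>, C) (A, \<phi>, B) = (A, compose (Carrier A) \<psi> \<phi>, C)"
  unfolding alg_cat_def by (rule Comp_triple_cat) (use assms in \<open>auto simp: Hom_triple_cat\<close>)

lemma category_alg_cat:
  assumes "\<forall>A\<in>V. is_algebra \<Omega> A"
  shows "category (alg_cat \<Omega> V)"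
  unfolding alg_cat_def
proof (rule category_triple_cat, goal_cases)
  case (1 A)
  then show ?case using assms alg_hom_id by blast
next
  case (2 A B C \<phi> \<psi>)
  then show ?case using assms alg_hom_compose by blast
next
  case (3 A B \<phi>)
  then show ?case
    by (intro extensionalityI[where A = "Carrier A"])
      (auto simp: compose_eq alg_hom_in alg_hom_ext)
next
  case (4 A B \<phi>)
  then show ?case
    by (intro extensionalityI[where A = "Carrier A"])
      (auto simp: compose_eq alg_hom_in alg_hom_ext)
next
  case (5 A B C D \<phi> \<psi> \<chi>)
  then show ?case by (auto simp: compose_def fun_eq_iff alg_hom_in)
qed


section \<open>Affine spaces and affine systems\<close>

locale affine_base =
  fixes \<Omega> :: "('l, 'i) optype"
    and V :: "('l, 'i, 'b) algebra set"
    and X :: "('xo, 'xa) category"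
    and T :: "('xo, 'xa, 'l, 'i, 'b) base_func"
  assumes variety: "variety \<Omega> V"
    and T: "is_functor X (op_cat (alg_cat \<Omega> V)) T"
begin

sublocale X: category X using T by (rule functor_dom)

abbreviation "Spc \<equiv> AfSpc \<Omega> V X T"
abbreviation "Sys \<equiv> AfSys \<Omega> V X T"
abbreviation "\<E> \<equiv> E_func \<Omega> V X T"
abbreviation "\<S> \<equiv> Spat_func \<Omega> V X T"

text \<open>The map \<open>(Tf)\<^sup>o\<^sup>p\<close>, which goes from the algebra of the codomain of \<open>f\<close> to that of its domain.\<close>

abbreviation Tmap :: "'xa \<Rightarrow> 'b \<Rightarrow> 'b" where
  "Tmap f \<equiv> fst (snd (ArrMap T f))"

lemma V_algebra: "A \<in> V \<Longrightarrow> is_algebra \<Omega> A"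
  by (rule bspec[OF conjunct1[OF variety[unfolded variety_def]]])

lemma V_subalgebra: "\<lbrakk>A \<in> V; subalgebra \<Omega> S A\<rbrakk> \<Longrightarrow> S \<in> V"
  by (rule conjunct1[OF conjunct2[OF conjunct2[OF variety[unfolded variety_def]]],
        THEN bspec, THEN spec, THEN mp])

lemma T_Obj: "x \<in> Obj X \<Longrightarrow> ObjMap T x \<in> V"
  using functor_Obj[OF T] by (simp add: Obj_op_cat Obj_alg_cat)

lemma T_algebra: "x \<in> Obj X \<Longrightarrow> is_algebra \<Omega> (ObjMap T x)"
  by (rule V_algebra[OF T_Obj])

lemma T_Hom:
  assumes "f \<in> Hom X x y"
  shows T_Arr_eq: "ArrMap T f = (ObjMap T y, Tmap f, ObjMap T x)"
    and Tmap_hom: "Tmap f \<in> alg_hom \<Omega> (ObjMap T y) (ObjMap T x)"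
  using functor_Hom[OF T assms] by (auto simp: Hom_op_cat Hom_alg_cat)

lemma Tmap_Ident: "x \<in> Obj X \<Longrightarrow> Tmap (Ident X x) = (\<lambda>\<alpha>\<in>Carrier (ObjMap T x). \<alpha>)"
  by (simp add: functor_Ident[OF T] Ident_op_cat Ident_alg_cat T_Obj)

lemma Tmap_Comp:
  assumes f: "f \<in> Hom X x y" and g: "g \<in> Hom X y z" and \<alpha>: "\<alpha> \<in> Carrier (ObjMap T z)"
  shows "Tmap (Comp X g f) \<alpha> = Tmap f (Tmap g \<alpha>)"
proof -
  have "ArrMap T (Comp X g f) = Comp (alg_cat \<Omega> V) (ArrMap T f) (ArrMap T g)"
    by (simp add: functor_Comp[OF T f g] Comp_op_cat)
  also have "\<dots> = Comp (alg_cat \<Omega> V) (ObjMap T y, Tmap f, ObjMap T x) (ObjMap T z, Tmap g, ObjMap T y)"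
    \<comment> \<open>used from right to left, as \<open>Tmap f\<close> itself contains \<open>ArrMap T f\<close>\<close>
    by (simp only: T_Arr_eq[OF f, symmetric] T_Arr_eq[OF g, symmetric])
  also have "\<dots> = (ObjMap T z, compose (Carrier (ObjMap T z)) (Tmap f) (Tmap g), ObjMap T x)"
    by (rule Comp_alg_cat[OF Tmap_hom[OF g] Tmap_hom[OF f]])
      (use X.Hom_Obj[OF f] X.Hom_Obj[OF g] T_Obj in auto)
  finally show ?thesis using \<alpha> by (simp add: compose_eq)
qed

lemma Obj_Spc: "(x, \<tau>) \<in> Obj Spc \<longleftrightarrow> x \<in> Obj X \<and> \<tau> \<in> V \<and> subalgebra \<Omega> \<tau> (ObjMap T x)"
  by (simp add: AfSpc_def Obj_triple_cat)

lemma Hom_Spc: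
  "u \<in> Hom Spc (x1, \<tau>1) (x2, \<tau>2) \<longleftrightarrow> (x1, \<tau>1) \<in> Obj Spc \<and> (x2, \<tau>2) \<in> Obj Spc \<and>
    (\<exists>f. u = ((x1, \<tau>1), f, (x2, \<tau>2)) \<and> f \<in> Hom X x1 x2 \<and>
       (\<forall>\<alpha>\<in>Carrier \<tau>2. Tmap f \<alpha> \<in> Carrier \<tau>1))"
  by (auto simp: AfSpc_def Obj_triple_cat Hom_triple_cat)

lemma Ident_Spc: "(x, \<tau>) \<in> Obj Spc \<Longrightarrow> Ident Spc (x, \<tau>) = ((x, \<tau>), Ident X x, (x, \<tau>))"
  by (simp add: AfSpc_def Obj_triple_cat Ident_triple_cat)

lemma Comp_Spc:
  assumes "(p1, f, p2) \<in> Hom Spc p1 p2" "(p2, g, p3) \<in> Hom Spc p2 p3"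
  shows "Comp Spc (p2, g, p3) (p1, f, p2) = (p1, Comp X g f, p3)"
  using Comp_triple_cat[OF assms[unfolded AfSpc_def]] by (simp add: AfSpc_def)

lemma category_Spc: "category Spc"
  unfolding AfSpc_def
proof (rule category_triple_cat, goal_cases)
  case (1 p)
  then show ?case by (auto simp: X.Ident_in Tmap_Ident dest: subsetD[OF subalgebraD(3)])
next
  case (2 p1 p2 p3 f g)
  then show ?case
    by (auto simp: X.Comp_in Tmap_Comp dest!: subalgebraD(3))
qed (auto simp: X.Comp_Ident_left X.Comp_Ident_right X.Comp_assoc)

text \<open>The structure map of a system over \<open>x\<close> is determined by the homomorphism \<open>k\<close> underlying it:
  this is the general shape of an affine system.\<close>

abbreviation sys :: "'xo \<Rightarrow> ('b \<Rightarrow> 'b) \<Rightarrow> ('l, 'i, 'b) algebra \<Rightarrow> ('xo, 'l, 'i, 'b) system" where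
  "sys x k B \<equiv> (x, (B, k, ObjMap T x), B)"

lemma category_alg_op: "category (op_cat (alg_cat \<Omega> V))"
  by (rule category_op_cat, rule category_alg_cat) (simp add: V_algebra)

lemma category_Sys: "category Sys"
  unfolding AfSys_def by (rule category_comma_cat[OF T is_functor_id_func[OF category_alg_op]])

lemma Obj_Sys:
  "(x, \<kappa>, B) \<in> Obj Sys \<longleftrightarrow>
    (\<exists>k. \<kappa> = (B, k, ObjMap T x) \<and> x \<in> Obj X \<and> B \<in> V \<and> k \<in> alg_hom \<Omega> B (ObjMap T x))"
  using T_Obj
  by (auto simp: AfSys_def Obj_comma_cat Obj_op_cat Obj_alg_cat Hom_op_cat Hom_alg_cat ObjMap_id_func)

lemma Obj_SysE:
  assumes "s \<in> Obj Sys"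
  obtains x k B where "s = sys x k B" "x \<in> Obj X" "B \<in> V" "k \<in> alg_hom \<Omega> B (ObjMap T x)"
  using assms by (cases s) (auto simp: Obj_Sys)

text \<open>The commuting square of the comma category, read elementwise in the variety.\<close>

lemma Hom_Sys:
  "u \<in> Hom Sys (sys x1 k1 B1) (sys x2 k2 B2) \<longleftrightarrow>
    sys x1 k1 B1 \<in> Obj Sys \<and> sys x2 k2 B2 \<in> Obj Sys \<and>
    (\<exists>f h. u = (sys x1 k1 B1, (f, (B2, h, B1)), sys x2 k2 B2) \<and> f \<in> Hom X x1 x2 \<and>
       h \<in> alg_hom \<Omega> B2 B1 \<and> (\<forall>b\<in>Carrier B2. Tmap f (k2 b) = k1 (h b)))"
proof -
  let ?B = "alg_cat \<Omega> V"
  have square: "Comp (op_cat ?B) (B2, k2, ObjMap T x2) (ArrMap T f)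
        = Comp (op_cat ?B) (ArrMap (id_func (op_cat ?B)) (B2, h, B1)) (B1, k1, ObjMap T x1)
      \<longleftrightarrow> (\<forall>b\<in>Carrier B2. Tmap f (k2 b) = k1 (h b))"
    if o1: "sys x1 k1 B1 \<in> Obj Sys" and o2: "sys x2 k2 B2 \<in> Obj Sys"
      and f: "f \<in> Hom X x1 x2" and h: "h \<in> alg_hom \<Omega> B2 B1" for f h
  proof -
    have k1: "x1 \<in> Obj X" "B1 \<in> V" "k1 \<in> alg_hom \<Omega> B1 (ObjMap T x1)"
      and k2: "x2 \<in> Obj X" "B2 \<in> V" "k2 \<in> alg_hom \<Omega> B2 (ObjMap T x2)"
      using o1 o2 by (auto simp: Obj_Sys)
    have "(B2, h, B1) \<in> Hom (op_cat ?B) B1 B2"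
      using h k1 k2 by (simp add: Hom_op_cat Hom_alg_cat)
    then have "ArrMap (id_func (op_cat ?B)) (B2, h, B1) = (B2, h, B1)"
      by (simp add: ArrMap_id_func HomD(1))
    moreover have "Comp ?B (ArrMap T f) (B2, k2, ObjMap T x2)
        = (B2, compose (Carrier B2) (Tmap f) k2, ObjMap T x1)"
      using Comp_alg_cat[OF k2(3) Tmap_hom[OF f] k2(2) T_Obj[OF k2(1)] T_Obj[OF k1(1)]]
      by (simp only: T_Arr_eq[OF f, symmetric])
    moreover have "Comp ?B (B1, k1, ObjMap T x1) (B2, h, B1)
        = (B2, compose (Carrier B2) k1 h, ObjMap T x1)"
      by (rule Comp_alg_cat[OF h k1(3) k2(2) k1(2) T_Obj[OF k1(1)]])
    ultimately show ?thesis
      by (auto simp: Comp_op_cat compose_def fun_eq_iff restrict_def)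
  qed
  have hom: "g \<in> Hom (op_cat ?B) B1 B2 \<longleftrightarrow> (\<exists>h\<in>alg_hom \<Omega> B2 B1. g = (B2, h, B1))"
    if "sys x1 k1 B1 \<in> Obj Sys" "sys x2 k2 B2 \<in> Obj Sys" for g
    using that by (auto simp: Hom_op_cat Hom_alg_cat Obj_Sys)
  have "u \<in> Hom Sys (sys x1 k1 B1) (sys x2 k2 B2) \<longleftrightarrow>
    sys x1 k1 B1 \<in> Obj Sys \<and> sys x2 k2 B2 \<in> Obj Sys \<and>
    (\<exists>f g. u = (sys x1 k1 B1, (f, g), sys x2 k2 B2) \<and> f \<in> Hom X x1 x2 \<and>
       g \<in> Hom (op_cat ?B) B1 B2 \<and>
       Comp (op_cat ?B) (B2, k2, ObjMap T x2) (ArrMap T f)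
         = Comp (op_cat ?B) (ArrMap (id_func (op_cat ?B)) g) (B1, k1, ObjMap T x1))"
    unfolding AfSys_def by (rule Hom_comma_cat)
  also have "\<dots> \<longleftrightarrow> sys x1 k1 B1 \<in> Obj Sys \<and> sys x2 k2 B2 \<in> Obj Sys \<and>
    (\<exists>f h. u = (sys x1 k1 B1, (f, (B2, h, B1)), sys x2 k2 B2) \<and> f \<in> Hom X x1 x2 \<and>
       h \<in> alg_hom \<Omega> B2 B1 \<and> (\<forall>b\<in>Carrier B2. Tmap f (k2 b) = k1 (h b)))"
  proof (cases "sys x1 k1 B1 \<in> Obj Sys \<and> sys x2 k2 B2 \<in> Obj Sys")
    case True
    then have o: "sys x1 k1 B1 \<in> Obj Sys" "sys x2 k2 B2 \<in> Obj Sys" by blast+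
    show ?thesis
      by (simp only: o hom[OF o] bex_simps ex_simps conj_assoc simp_thms)
        (metis (no_types, lifting) square[OF o])
  qed blast
  finally show ?thesis .
qed

lemma Ident_Sys:
  assumes "sys x k B \<in> Obj Sys"
  shows "Ident Sys (sys x k B) = (sys x k B, (Ident X x, (B, \<lambda>b\<in>Carrier B. b, B)), sys x k B)"
  using Ident_comma_cat[OF assms[unfolded AfSys_def]] assms
  by (auto simp: AfSys_def[symmetric] Ident_op_cat Ident_alg_cat Obj_Sys)

lemma Comp_Sys:
  assumes u: "(sys x1 k1 B1, (f, (B2, h, B1)), sys x2 k2 B2) \<in> Hom Sys (sys x1 k1 B1) (sys x2 k2 B2)"
    and v: "(sys x2 k2 B2, (f', (B3, h', B2)), sys x3 k3 B3) \<in> Hom Sys (sys x2 k2 B2) (sys x3 k3 B3)"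
  shows "Comp Sys (sys x2 k2 B2, (f', (B3, h', B2)), sys x3 k3 B3)
      (sys x1 k1 B1, (f, (B2, h, B1)), sys x2 k2 B2) =
    (sys x1 k1 B1, (Comp X f' f, (B3, compose (Carrier B3) h h', B1)), sys x3 k3 B3)"
proof -
  have "Comp (alg_cat \<Omega> V) (B2, h, B1) (B3, h', B2) = (B3, compose (Carrier B3) h h', B1)"
    by (rule Comp_alg_cat) (use u v in \<open>auto simp: Hom_Sys Obj_Sys\<close>)
  then show ?thesis
    using Comp_comma_cat[OF u[unfolded AfSys_def] v[unfolded AfSys_def]]
    by (simp add: AfSys_def Comp_op_cat)
qed

lemma E_obj_eq: "E_obj T (x, \<tau>) = sys x (\<lambda>\<alpha>\<in>Carrier \<tau>. \<alpha>) \<tau>"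
  by (simp add: E_obj_def)

lemma E_Obj_in:
  "(x, \<tau>) \<in> Obj Spc \<Longrightarrow> sys x (\<lambda>\<alpha>\<in>Carrier \<tau>. \<alpha>) \<tau> \<in> Obj Sys"
  by (auto simp: Obj_Spc Obj_Sys alg_hom_inclusion)

lemma ObjMap_E: "(x, \<tau>) \<in> Obj Spc \<Longrightarrow> ObjMap \<E> (x, \<tau>) = sys x (\<lambda>\<alpha>\<in>Carrier \<tau>. \<alpha>) \<tau>"
  by (simp add: E_func_def E_obj_eq)

lemma ArrMap_E:
  assumes "((x1, \<tau>1), f, (x2, \<tau>2)) \<in> Hom Spc (x1, \<tau>1) (x2, \<tau>2)"
  shows "ArrMap \<E> ((x1, \<tau>1), f, (x2, \<tau>2)) =
    (sys x1 (\<lambda>\<alpha>\<in>Carrier \<tau>1. \<alpha>) \<tau>1, (f, (\<tau>2, restrict (Tmap f) (Carrier \<tau>2), \<tau>1)),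
     sys x2 (\<lambda>\<alpha>\<in>Carrier \<tau>2. \<alpha>) \<tau>2)"
  using HomD(1)[OF assms] by (simp add: E_func_def E_obj_eq)

lemma E_Hom:
  assumes u: "((x1, \<tau>1), f, (x2, \<tau>2)) \<in> Hom Spc (x1, \<tau>1) (x2, \<tau>2)"
  shows "(sys x1 (\<lambda>\<alpha>\<in>Carrier \<tau>1. \<alpha>) \<tau>1, (f, (\<tau>2, restrict (Tmap f) (Carrier \<tau>2), \<tau>1)),
     sys x2 (\<lambda>\<alpha>\<in>Carrier \<tau>2. \<alpha>) \<tau>2)
    \<in> Hom Sys (sys x1 (\<lambda>\<alpha>\<in>Carrier \<tau>1. \<alpha>) \<tau>1) (sys x2 (\<lambda>\<alpha>\<in>Carrier \<tau>2. \<alpha>) \<tau>2)"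
proof -
  have f: "f \<in> Hom X x1 x2" and o: "(x1, \<tau>1) \<in> Obj Spc" "(x2, \<tau>2) \<in> Obj Spc"
    and im: "\<And>\<alpha>. \<alpha> \<in> Carrier \<tau>2 \<Longrightarrow> Tmap f \<alpha> \<in> Carrier \<tau>1"
    using u by (auto simp: Hom_Spc)
  then show ?thesis
    using alg_hom_restrict[OF Tmap_hom[OF f] _ _ im]
    by (auto simp: Hom_Sys E_Obj_in Obj_Spc)
qed

lemma is_functor_E: "is_functor Spc Sys \<E>"
proof (rule is_functorI)
  interpret Spc: category Spc by (rule category_Spc)
  show "category Spc" "category Sys" by (rule category_Spc category_Sys)+
  show "ObjMap \<E> \<in> Obj Spc \<rightarrow>\<^sub>E Obj Sys"
    by (auto simp: E_func_def E_obj_eq E_Obj_in)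
  show "ArrMap \<E> \<in> extensional (Arr Spc)" by (simp add: E_func_def)
  show "ArrMap \<E> u \<in> Hom Sys (ObjMap \<E> p) (ObjMap \<E> q)" if u: "u \<in> Hom Spc p q" for p q u
    using u Spc.Hom_Obj[OF u] E_Hom
    by (cases p, cases q) (auto simp: Hom_Spc ArrMap_E ObjMap_E)
  show "ArrMap \<E> (Ident Spc p) = Ident Sys (ObjMap \<E> p)" if p: "p \<in> Obj Spc" for p
  proof -
    obtain x \<tau> where p_eq: "p = (x, \<tau>)" by (cases p)
    have x: "x \<in> Obj X" and \<tau>: "subalgebra \<Omega> \<tau> (ObjMap T x)" using p by (auto simp: p_eq Obj_Spc)
    have "restrict (Tmap (Ident X x)) (Carrier \<tau>) = (\<lambda>\<alpha>\<in>Carrier \<tau>. \<alpha>)"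
      using subalgebraD(3)[OF \<tau>] by (auto simp: Tmap_Ident[OF x] restrict_def fun_eq_iff)
    then show ?thesis
      using p Spc.Ident_in[OF p] by (simp add: p_eq Ident_Spc ArrMap_E ObjMap_E Ident_Sys E_Obj_in)
  qed
  show "ArrMap \<E> (Comp Spc v u) = Comp Sys (ArrMap \<E> v) (ArrMap \<E> u)"
    if u: "u \<in> Hom Spc p q" and v: "v \<in> Hom Spc q r" for p q r u v
  proof -
    obtain x1 \<tau>1 x2 \<tau>2 x3 \<tau>3 where pqr: "p = (x1, \<tau>1)" "q = (x2, \<tau>2)" "r = (x3, \<tau>3)"
      by (metis surj_pair)
    obtain f where u_eq: "u = ((x1, \<tau>1), f, (x2, \<tau>2))" and f: "f \<in> Hom X x1 x2"
      using u by (auto simp: pqr Hom_Spc)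
    obtain g where v_eq: "v = ((x2, \<tau>2), g, (x3, \<tau>3))" and g: "g \<in> Hom X x2 x3"
      and im: "\<And>\<alpha>. \<alpha> \<in> Carrier \<tau>3 \<Longrightarrow> Tmap g \<alpha> \<in> Carrier \<tau>2" and \<tau>3: "subalgebra \<Omega> \<tau>3 (ObjMap T x3)"
      using v by (auto simp: pqr Hom_Spc Obj_Spc)
    have "restrict (Tmap (Comp X g f)) (Carrier \<tau>3)
        = compose (Carrier \<tau>3) (restrict (Tmap f) (Carrier \<tau>2)) (restrict (Tmap g) (Carrier \<tau>3))"
      using im Tmap_Comp[OF f g] subalgebraD(3)[OF \<tau>3]
      by (auto simp: compose_def restrict_def fun_eq_iff)
    then show ?thesis
      using u v Spc.Comp_in[OF u v]
      by (simp add: pqr u_eq v_eq Comp_Spc ArrMap_E Comp_Sys[OF E_Hom E_Hom])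
  qed
qed

abbreviation spat :: "'xo \<Rightarrow> ('b \<Rightarrow> 'b) \<Rightarrow> ('l, 'i, 'b) algebra \<Rightarrow> ('l, 'i, 'b) algebra" where
  "spat x k B \<equiv> restrict_alg \<Omega> (ObjMap T x) (k ` Carrier B)"

lemma Spat_obj_eq: "Spat_obj \<Omega> T (sys x k B) = (x, spat x k B)"
  by (simp add: Spat_obj_def)

lemma spat_subalgebra:
  assumes "sys x k B \<in> Obj Sys"
  shows "subalgebra \<Omega> (spat x k B) (ObjMap T x)"
  using assms by (auto simp: Obj_Sys intro: subalgebra_image V_algebra T_algebra)

lemma Spat_Obj_in: "sys x k B \<in> Obj Sys \<Longrightarrow> (x, spat x k B) \<in> Obj Spc"
  using spat_subalgebra[of x B k] V_subalgebra[OF T_Obj] by (auto simp: Obj_Spc Obj_Sys)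

lemma ObjMap_Spat: "sys x k B \<in> Obj Sys \<Longrightarrow> ObjMap \<S> (sys x k B) = (x, spat x k B)"
  by (simp add: Spat_func_def Spat_obj_eq)

lemma ArrMap_Spat:
  assumes "(sys x1 k1 B1, (f, \<phi>), sys x2 k2 B2) \<in> Hom Sys (sys x1 k1 B1) (sys x2 k2 B2)"
  shows "ArrMap \<S> (sys x1 k1 B1, (f, \<phi>), sys x2 k2 B2) = ((x1, spat x1 k1 B1), f, (x2, spat x2 k2 B2))"
  using HomD(1)[OF assms] by (simp add: Spat_func_def Spat_obj_eq)

text \<open>For a system morphism, \<open>Tmap f\<close> maps the image of \<open>k2\<close> into that of \<open>k1\<close>, because the square
  gives \<open>Tmap f (k2 b) = k1 (h b)\<close>.\<close>

lemma Spat_Hom: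
  assumes u: "(sys x1 k1 B1, (f, \<phi>), sys x2 k2 B2) \<in> Hom Sys (sys x1 k1 B1) (sys x2 k2 B2)"
  shows "((x1, spat x1 k1 B1), f, (x2, spat x2 k2 B2))
    \<in> Hom Spc (x1, spat x1 k1 B1) (x2, spat x2 k2 B2)"
  using u by (auto simp: Hom_Sys Hom_Spc Spat_Obj_in Carrier_restrict_alg alg_hom_in)

lemma Hom_SysE:
  assumes u: "u \<in> Hom Sys s1 s2"
  obtains x1 k1 B1 x2 k2 B2 f h where
    "s1 = sys x1 k1 B1" "s2 = sys x2 k2 B2" "u = (sys x1 k1 B1, (f, (B2, h, B1)), sys x2 k2 B2)"
    "f \<in> Hom X x1 x2" "h \<in> alg_hom \<Omega> B2 B1" "\<forall>b\<in>Carrier B2. Tmap f (k2 b) = k1 (h b)"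
proof -
  interpret Sys: category Sys by (rule category_Sys)
  obtain x1 k1 B1 where s1: "s1 = sys x1 k1 B1" using Obj_SysE[OF Sys.Hom_Obj(1)[OF u]] by metis
  obtain x2 k2 B2 where s2: "s2 = sys x2 k2 B2" using Obj_SysE[OF Sys.Hom_Obj(2)[OF u]] by metis
  show ?thesis using u[unfolded s1 s2 Hom_Sys] that[OF s1 s2] by blast
qed

lemma is_functor_Spat: "is_functor Sys Spc \<S>"
proof (rule is_functorI)
  interpret Sys: category Sys by (rule category_Sys)
  show "category Spc" "category Sys" by (rule category_Spc category_Sys)+
  show "ObjMap \<S> \<in> Obj Sys \<rightarrow>\<^sub>E Obj Spc"
  proof (rule PiE_I)
    fix s assume s: "s \<in> Obj Sys"
    then obtain x k B where "s = sys x k B" by (rule Obj_SysE)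
    with s show "ObjMap \<S> s \<in> Obj Spc" by (simp only: ObjMap_Spat Spat_Obj_in)
  qed (simp add: Spat_func_def)
  show "ArrMap \<S> \<in> extensional (Arr Sys)" by (simp add: Spat_func_def)
  show "ArrMap \<S> u \<in> Hom Spc (ObjMap \<S> s1) (ObjMap \<S> s2)" if u: "u \<in> Hom Sys s1 s2" for s1 s2 u
  proof -
    obtain x1 k1 B1 x2 k2 B2 f h where s1: "s1 = sys x1 k1 B1" and s2: "s2 = sys x2 k2 B2"
      and u_eq: "u = (sys x1 k1 B1, (f, (B2, h, B1)), sys x2 k2 B2)"
      using u by (rule Hom_SysE)
    note uH = u[unfolded s1 s2 u_eq]
    show ?thesis
      unfolding s1 s2 u_eq ArrMap_Spat[OF uH] ObjMap_Spat[OF Sys.Hom_Obj(1)[OF uH]]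
        ObjMap_Spat[OF Sys.Hom_Obj(2)[OF uH]]
      by (rule Spat_Hom[OF uH])
  qed
  show "ArrMap \<S> (Ident Sys s) = Ident Spc (ObjMap \<S> s)" if s: "s \<in> Obj Sys" for s
  proof -
    obtain x k B where s_eq: "s = sys x k B" using s by (rule Obj_SysE)
    show ?thesis
      using s Sys.Ident_in[OF s]
      by (simp add: s_eq Ident_Sys ArrMap_Spat ObjMap_Spat Ident_Spc Spat_Obj_in)
  qed
  show "ArrMap \<S> (Comp Sys v u) = Comp Spc (ArrMap \<S> v) (ArrMap \<S> u)"
    if u: "u \<in> Hom Sys s1 s2" and v: "v \<in> Hom Sys s2 s3" for s1 s2 s3 u v
  proof -
    obtain x1 k1 B1 x2 k2 B2 f h where s1: "s1 = sys x1 k1 B1" and s2: "s2 = sys x2 k2 B2"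
      and u_eq: "u = (sys x1 k1 B1, (f, (B2, h, B1)), sys x2 k2 B2)"
      using u by (rule Hom_SysE)
    obtain x3 k3 B3 g h' where s3: "s3 = sys x3 k3 B3"
      and v_eq: "v = (sys x2 k2 B2, (g, (B3, h', B2)), sys x3 k3 B3)"
      using v by (rule Hom_SysE) (simp add: s2)
    show ?thesis
      using u v Sys.Comp_in[OF u v]
      by (simp add: s1 s2 s3 u_eq v_eq Comp_Sys ArrMap_Spat Comp_Spc[OF Spat_Hom Spat_Hom])
  qed
qed

text \<open>The second component is \<open>\<kappa>\<^sup>o\<^sup>p\<close> with its codomain cut down to the image, as an arrow of the
  opposite category from the image to \<open>B\<close>.\<close>

definition spat_counit :: "('xo, 'l, 'i, 'b) system \<Rightarrow> ('xo, 'xa, 'l, 'i, 'b) system_arr" where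
  "spat_counit = restrict
     (\<lambda>s. (E_obj T (Spat_obj \<Omega> T s),
       (Ident X (fst s), (snd (snd s), fst (snd (fst (snd s))), snd (Spat_obj \<Omega> T s))), s))
     (Obj Sys)"

abbreviation esys :: "'xo \<Rightarrow> ('l, 'i, 'b) algebra \<Rightarrow> ('xo, 'l, 'i, 'b) system" where
  "esys x \<tau> \<equiv> sys x (\<lambda>\<alpha>\<in>Carrier \<tau>. \<alpha>) \<tau>"

lemma spat_counit_eq:
  assumes "sys x k B \<in> Obj Sys"
  shows "spat_counit (sys x k B) =
    (esys x (spat x k B), (Ident X x, (B, k, spat x k B)), sys x k B)"
  using assms by (simp add: spat_counit_def E_obj_eq Spat_obj_eq)

lemma spat_counit_Hom:
  assumes s: "sys x k B \<in> Obj Sys"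
  shows "(esys x (spat x k B), (Ident X x, (B, k, spat x k B)), sys x k B)
    \<in> Hom Sys (esys x (spat x k B)) (sys x k B)"
proof -
  have x: "x \<in> Obj X" and B: "is_algebra \<Omega> B" and k: "k \<in> alg_hom \<Omega> B (ObjMap T x)"
    using s V_algebra by (auto simp: Obj_Sys)
  have "k \<in> alg_hom \<Omega> B (spat x k B)"
    by (rule alg_hom_corestrict[OF k B spat_subalgebra[OF s]]) (simp add: Carrier_restrict_alg)
  then show ?thesis
    using s x E_Obj_in[OF Spat_Obj_in[OF s]]
    by (simp add: Hom_Sys X.Ident_in Tmap_Ident Carrier_restrict_alg alg_hom_in[OF k])
qed

text \<open>The square for naturality of the counit at \<open>(f, \<phi>)\<close> consists, in the variety, of the two
  composites \<open>B2 \<rightarrow> k1(B1)\<close> that send \<open>b\<close> to \<open>Tmap f (k2 b)\<close> and to \<open>k1 (h b)\<close>; they agree because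
  \<open>(f, \<phi>)\<close> is a morphism of systems.\<close>

lemma spat_strict_coreflection: "strict_coreflection Spc Sys \<E> \<S> spat_counit"
proof
  interpret Spc: category Spc by (rule category_Spc)
  interpret Sys: category Sys by (rule category_Sys)
  show E: "is_functor Spc Sys \<E>" and S: "is_functor Sys Spc \<S>"
    by (rule is_functor_E is_functor_Spat)+
  have spat_E: "restrict_alg \<Omega> (ObjMap T x) (Carrier \<tau>) = \<tau>" if "(x, \<tau>) \<in> Obj Spc" for x \<tau>
    using that restrict_alg_subalgebra[of \<Omega> \<tau> "ObjMap T x"] by (simp add: Obj_Spc)
  show "comp_func Spc \<S> \<E> = id_func Spc"
  proof (rule functor_eqI[where C = Spc])
    fix p assume "p \<in> Obj Spc"
    then show "ObjMap (comp_func Spc \<S> \<E>) p = ObjMap (id_func Spc) p"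
      by (cases p) (simp add: func_apply ObjMap_E ObjMap_Spat E_Obj_in spat_E)
  next
    fix u assume u: "u \<in> Arr Spc"
    obtain x1 \<tau>1 x2 \<tau>2 where pq: "Dom Spc u = (x1, \<tau>1)" "Cod Spc u = (x2, \<tau>2)" by (metis surj_pair)
    have uH: "u \<in> Hom Spc (x1, \<tau>1) (x2, \<tau>2)" using Spc.Arr_Hom[OF u] by (simp add: pq)
    then obtain f where u_eq: "u = ((x1, \<tau>1), f, (x2, \<tau>2))" by (auto simp: Hom_Spc)
    show "ArrMap (comp_func Spc \<S> \<E>) u = ArrMap (id_func Spc) u"
      using u uH Spc.Hom_Obj[OF uH] by (simp add: func_apply u_eq ArrMap_E ArrMap_Spat[OF E_Hom] spat_E)
  qed (simp_all add: comp_func_def id_func_def)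
  show "nat_trans Sys Sys (comp_func Sys \<E> \<S>) (id_func Sys) spat_counit"
  proof (rule nat_transI)
    show "is_functor Sys Sys (comp_func Sys \<E> \<S>)" by (rule is_functor_comp_func[OF S E])
    show "is_functor Sys Sys (id_func Sys)" by (rule is_functor_id_func[OF category_Sys])
    show "spat_counit \<in> extensional (Obj Sys)" by (simp add: spat_counit_def)
    show "spat_counit s \<in> Hom Sys (ObjMap (comp_func Sys \<E> \<S>) s) (ObjMap (id_func Sys) s)"
      if s: "s \<in> Obj Sys" for s
    proof -
      obtain x k B where s_eq: "s = sys x k B" using s by (rule Obj_SysE)
      show ?thesis
        using s spat_counit_Hom[of x B k]
        by (simp add: s_eq func_apply spat_counit_eq ObjMap_Spat ObjMap_E Spat_Obj_in)
    qed
    show "Comp Sys (spat_counit s2) (ArrMap (comp_func Sys \<E> \<S>) u)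
        = Comp Sys (ArrMap (id_func Sys) u) (spat_counit s1)"
      if u: "u \<in> Hom Sys s1 s2" for s1 s2 u
    proof -
      obtain x1 k1 B1 x2 k2 B2 f h where s1: "s1 = sys x1 k1 B1" and s2: "s2 = sys x2 k2 B2"
        and u_eq: "u = (sys x1 k1 B1, (f, (B2, h, B1)), sys x2 k2 B2)"
        and f: "f \<in> Hom X x1 x2" and "h \<in> alg_hom \<Omega> B2 B1"
        and sq: "\<forall>b\<in>Carrier B2. Tmap f (k2 b) = k1 (h b)"
        using u by (rule Hom_SysE)
      have o: "sys x1 k1 B1 \<in> Obj Sys" "sys x2 k2 B2 \<in> Obj Sys"
        using Sys.Hom_Obj[OF u] by (simp_all add: s1 s2)
      note uH = u[unfolded s1 s2 u_eq]
      have "compose (Carrier B2) (restrict (Tmap f) (Carrier (spat x2 k2 B2))) k2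
          = compose (Carrier B2) k1 h"
        using sq by (auto simp: compose_def fun_eq_iff Carrier_restrict_alg)
      then show ?thesis
        using HomD(1)[OF uH]
        by (simp add: s1 s2 u_eq func_apply o spat_counit_eq ArrMap_Spat[OF uH]
            ArrMap_E[OF Spat_Hom[OF uH]] Comp_Sys[OF E_Hom[OF Spat_Hom[OF uH]] spat_counit_Hom]
            Comp_Sys[OF spat_counit_Hom uH] X.Comp_Ident_left[OF f] X.Comp_Ident_right[OF f])
    qed
  qed
  show "spat_counit (ObjMap \<E> p) = Ident Sys (ObjMap \<E> p)" if "p \<in> Obj Spc" for p
    using that
    by (cases p) (simp add: ObjMap_E spat_counit_eq E_Obj_in Ident_Sys spat_E)
  show "ArrMap \<S> (spat_counit s) = Ident Spc (ObjMap \<S> s)" if s: "s \<in> Obj Sys" for s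
  proof -
    obtain x k B where s_eq: "s = sys x k B" using s by (rule Obj_SysE)
    have o: "sys x k B \<in> Obj Sys" using s by (simp add: s_eq)
    show ?thesis
      using o
      by (simp add: s_eq spat_counit_eq ArrMap_Spat[OF spat_counit_Hom] ObjMap_Spat Ident_Spc
          Spat_Obj_in spat_E)
  qed
qed

end

lemma IE_eq: "IE \<Omega> V X T = inst_func (AfSpc \<Omega> V X T) (E_func \<Omega> V X T)"
  by (simp add: IE_def inst_func_def SAfInst_def)

lemma ISpat_eq: "ISpat \<Omega> V X T = inst_func (AfSys \<Omega> V X T) (Spat_func \<Omega> V X T)"
  by (simp add: ISpat_def inst_func_def AfInst_def)

theorem theorem7:
  fixes \<Omega> :: "('l, 'i) optype"
    and V :: "('l, 'i, 'b) algebra set"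
    and X :: "('xo, 'xa) category"
    and T :: "('xo, 'xa, 'l, 'i, 'b) base_func"
  assumes "category X"
    and "variety \<Omega> V"
    and "is_functor X (op_cat (alg_cat \<Omega> V)) T"
  shows "let SAf = (SAfInst \<Omega> V X T ::
             (('s, 't, 'xo, 'xa, 'l, 'i, 'b) spatial_inst,
              ('s, 't, 'xo, 'xa, 'l, 'i, 'b) spatial_inst_arr) category);
             Af = (AfInst \<Omega> V X T ::
             (('s, 't, 'xo, 'xa, 'l, 'i, 'b) affine_inst,
              ('s, 't, 'xo, 'xa, 'l, 'i, 'b) affine_inst_arr) category)
         in full_embedding SAf Af (IE \<Omega> V X T)
          \<and> right_adjoint_left_inverse SAf Af (IE \<Omega> V X T) (ISpat \<Omega> V X T)
          \<and> (\<exists>D. full_coreflective_subcategory D Af \<and> isomorphic_cat SAf D)"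
proof -
  interpret affine_base \<Omega> V X T using assms(2,3) by unfold_locales
  interpret strict_coreflection Spc Sys \<E> \<S> spat_counit by (rule spat_strict_coreflection)
  interpret inst: strict_coreflection
    "SAfInst \<Omega> V X T :: (('s, 't, 'xo, 'xa, 'l, 'i, 'b) spatial_inst,
       ('s, 't, 'xo, 'xa, 'l, 'i, 'b) spatial_inst_arr) category"
    "AfInst \<Omega> V X T" "IE \<Omega> V X T" "ISpat \<Omega> V X T" inst_counit
    unfolding IE_eq ISpat_eq SAfInst_def AfInst_def by (rule inst_strict_coreflection)
  show ?thesis
    unfolding Let_def
    using inst.full_embedding inst.right_adjoint_left_inverse inst.full_coreflective_image
      inst.isomorphic_image
    by blast
qed

end
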